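(* Assume the setting and Assumption (A) described in the context, and let $f\in L^2(\Omega)$. Then there exists a unique $u_h=\{u_0,u_b\}\in V_h^0$ such that $$a_h(u_h;u_h,v)=(f,v_0)\qquad\text{for all } v=\{v_0,v_b\}\in V_h^0.$$
   Context: Let $\Omega\subset\mathbb{R}^d$ ($d=2,3$) be a polytopal domain and $\mathcal{T}_h$ a shape-regular partition of $\Omega$ into polygons/polyhedra; $h_T$ is the diameter of $T\in\mathcal{T}_h$ and $h=\max_T h_T$. Fix an integer $k\ge1$ and set $j=n+k-1$, where $n$ is the number of edges (faces) of each element. A weak function is a pair $v=\{v_0,v_b\}$ with $v_0$ defined in the interiors of elements and $v_b$ on element boundaries. The space $V_h$ consists of $v=\{v_0,v_b\}$ with $v_0|_T\in\mathbb{P}_k(T)$ for each $T$ and $v_b|_e\in\mathbb{P}_k(e)$ for each edge/face $e$, with $v_b$ single-valued on interior edges/faces; $V_h^0=\{v\in V_h: v_b=0 \text{ on }\partial\Omega\}$. The discrete weak gradient $\nabla_w v$ is defined elementwise as the unique $\nabla_w v|_T\in[\mathbb{P}_j(T)]^d$ with $$(\nabla_w v,\boldsymbol\tau)_T=-(v_0,\nabla\cdot\boldsymbol\tau)_T+\langle v_b,\boldsymbol\tau\cdot\boldsymbol n\rangle_{\partial T}\quad\forall\boldsymbol\tau\in[\mathbb{P}_j(T)]^d,$$ where $\boldsymbol n$ is the outward unit normal. Define $|\!|\!|v|\!|\!|^2=\sum_{T\in\mathcal{T}_h}(\nabla_w v,\nabla_w v)_T$, $\|v\|_{1,h}^2=\sum_{T\in\mathcal{T}_h}\big(\|\nabla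 v_0\|_T^2+h_T^{-1}\|v_0-v_b\|_{\partial T}^2\big)$, and, for $w,u,v\in V_h$, $a_h(w;u,v)=\sum_{T\in\mathcal{T}_h}\big(\kappa(x,|\nabla_w w|)\nabla_w u,\nabla_w v\big)_T$. Known facts that may be used: with $j=n+k-1$ there are constants $C_1,C_2>0$ with $C_1\|v\|_{1,h}\le|\!|\!|v|\!|\!|\le C_2\|v\|_{1,h}$ for all $v\in V_h$ (so $|\!|\!|\cdot|\!|\!|$ is a norm on $V_h^0$), and $\|v_0\|\le C\|v\|_{1,h}$ for $v\in V_h^0$. Assumption (A): $\kappa(x,s)$ is a Carathéodory function on $\Omega\times[0,\infty)$ and there are constants $0<\alpha<\beta$ with $\alpha(t-s)\le\kappa(x,t)t-\kappa(x,s)s\le\beta(t-s)$ for all $0\le s\le t$ and a.e. $x\in\Omega$. *)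

theory Defs
  imports "HOL-Analysis.Analysis"
begin

text \<open>Real polynomials of total degree at most k on the Euclidean space 'a:
  finite linear combinations of products of at most k linear forms.\<close>
definition Poly :: "nat \<Rightarrow> ('a::euclidean_space \<Rightarrow> real) set" where
  "Poly k = {p. \<exists>(N::nat) (c::nat \<Rightarrow> real) (m::nat \<Rightarrow> nat) (a::nat \<Rightarrow> nat \<Rightarrow> 'a).
      (\<forall>j<N. m j \<le> k) \<and> p = (\<lambda>x. \<Sum>j<N. c j * (\<Prod>i<m j. a j i \<bullet> x))}"

definition VPoly :: "nat \<Rightarrow> ('a::euclidean_space \<Rightarrow> 'a) set" where
  "VPoly j = {\<tau>. \<forall>b\<in>Basis. (\<lambda>x. \<tau> x \<bullet> b) \<in> Poly j}"

definition grad :: "('a::euclidean_space \<Rightarrow> real) \<Rightarrow> 'a \<Rightarrow> 'a" where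
  "grad f x = (\<Sum>b\<in>Basis. frechet_derivative f (at x) b *\<^sub>R b)"

definition divg :: "('a::euclidean_space \<Rightarrow> 'a) \<Rightarrow> 'a \<Rightarrow> real" where
  "divg \<tau> x = (\<Sum>b\<in>Basis. frechet_derivative \<tau> (at x) b \<bullet> b)"

definition normal_to :: "'a::euclidean_space set \<Rightarrow> 'a \<Rightarrow> bool" where
  "normal_to e \<nu> \<longleftrightarrow> norm \<nu> = 1 \<and> (\<forall>x\<in>e. \<forall>y\<in>e. (x - y) \<bullet> \<nu> = 0)"

definition outward_normal :: "'a::euclidean_space set \<Rightarrow> 'a set \<Rightarrow> 'a \<Rightarrow> bool" where
  "outward_normal T e \<nu> \<longleftrightarrow> normal_to e \<nu> \<and>
     (\<forall>x\<in>rel_interior e. \<exists>\<epsilon>>0. \<forall>t. 0 < t \<and> t < \<epsilon> \<longrightarrow>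
          x + t *\<^sub>R \<nu> \<notin> T \<and> x - t *\<^sub>R \<nu> \<in> interior T)"

definition onormal :: "'a::euclidean_space set \<Rightarrow> 'a set \<Rightarrow> 'a" where
  "onormal T e = (SOME \<nu>. outward_normal T e \<nu>)"

text \<open>Surface ((d-1)-dimensional) integral over a flat face e, defined by Cavalieri:
  the Lebesgue integral over the unit-height prism on e of g composed with the
  orthogonal projection onto the affine hull of e.\<close>
definition face_integral :: "'a::euclidean_space set \<Rightarrow> ('a \<Rightarrow> real) \<Rightarrow> real" where
  "face_integral e g =
     (let \<nu> = (SOME \<nu>. normal_to e \<nu>); z = (SOME z. z \<in> e) in
      set_lebesgue_integral lebesgue {y + t *\<^sub>R \<nu> | y t. y \<in> e \<and> 0 \<le> t \<and> t \<le> 1}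
        (\<lambda>x. g (x - ((x - z) \<bullet> \<nu>) *\<^sub>R \<nu>)))"

definition flat_face :: "'a::euclidean_space set \<Rightarrow> bool" where
  "flat_face e \<longleftrightarrow> (\<exists>S. finite S \<and> (\<forall>P\<in>S. polytope P) \<and> e = \<Union>S) \<and> connected e \<and>
     aff_dim e = int DIM('a) - 1 \<and> e = closure (rel_interior e)"

definition polytopal_mesh :: "'a::euclidean_space set \<Rightarrow> 'a set set \<Rightarrow> ('a set \<Rightarrow> 'a set set) \<Rightarrow> bool" where
  "polytopal_mesh \<Omega> Th F \<longleftrightarrow>
     open \<Omega> \<and> bounded \<Omega> \<and> connected \<Omega> \<and> \<Omega> \<noteq> {} \<and>
     finite Th \<and> Th \<noteq> {} \<and> \<Omega> = interior (\<Union>Th) \<and> closure \<Omega> = \<Union>Th \<and>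
     (\<forall>T\<in>Th. compact T \<and> interior T \<noteq> {} \<and> connected (interior T) \<and>
        T = closure (interior T) \<and>
        finite (F T) \<and> F T \<noteq> {} \<and> frontier T = \<Union>(F T) \<and>
        (\<forall>e\<in>F T. flat_face e \<and> (\<exists>\<nu>. outward_normal T e \<nu>))) \<and>
     (\<forall>T\<in>Th. \<forall>T'\<in>Th. T \<noteq> T' \<longrightarrow> interior T \<inter> interior T' = {}) \<and>
     (\<forall>T\<in>Th. \<forall>T'\<in>Th. \<forall>e\<in>F T. \<forall>e'\<in>F T'.
        e = e' \<or> rel_interior e \<inter> rel_interior e' = {}) \<and>
     (\<forall>T\<in>Th. \<forall>e\<in>F T. e \<subseteq> frontier \<Omega> \<or> (\<exists>T'\<in>Th. T' \<noteq> T \<and> e \<in> F T'))"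

text \<open>A weak function is a pair (v0, vb). Canonical representatives: v0 vanishes off the
  element interiors, vb vanishes off the relative interiors of the mesh faces; since vb is
  one global function, it is single-valued on interior faces.\<close>
type_synonym 'a wfun = "('a \<Rightarrow> real) \<times> ('a \<Rightarrow> real)"

definition Vh :: "'a::euclidean_space set set \<Rightarrow> ('a set \<Rightarrow> 'a set set) \<Rightarrow> nat \<Rightarrow> 'a wfun set" where
  "Vh Th F k = {v. (\<forall>T\<in>Th. \<exists>p\<in>Poly k. \<forall>x\<in>interior T. fst v x = p x) \<and>
                   (\<forall>x. x \<notin> \<Union>(interior ` Th) \<longrightarrow> fst v x = 0) \<and>
                   (\<forall>T\<in>Th. \<forall>e\<in>F T. \<exists>p\<in>Poly k. \<forall>x\<in>rel_interior e. snd v x = p x) \<and>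
                   (\<forall>x. x \<notin> \<Union>{rel_interior e | e T. T \<in> Th \<and> e \<in> F T} \<longrightarrow> snd v x = 0)}"

definition Vh0 :: "'a::euclidean_space set \<Rightarrow> 'a set set \<Rightarrow> ('a set \<Rightarrow> 'a set set) \<Rightarrow> nat \<Rightarrow> 'a wfun set" where
  "Vh0 \<Omega> Th F k = {v \<in> Vh Th F k. \<forall>T\<in>Th. \<forall>e\<in>F T. e \<subseteq> frontier \<Omega> \<longrightarrow>
                       (\<forall>x\<in>rel_interior e. snd v x = 0)}"

definition jdeg :: "('a set \<Rightarrow> 'a set set) \<Rightarrow> nat \<Rightarrow> 'a set \<Rightarrow> nat" where
  "jdeg F k T = card (F T) + k - 1"

definition wgrad :: "'a::euclidean_space set set \<Rightarrow> ('a set \<Rightarrow> 'a set set) \<Rightarrow> nat \<Rightarrow> 'a wfun \<Rightarrow> 'a \<Rightarrow> 'a" where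
  "wgrad Th F k v = (THE W. (\<forall>x. x \<notin> \<Union>(interior ` Th) \<longrightarrow> W x = 0) \<and>
     (\<forall>T\<in>Th. (\<exists>q\<in>VPoly (jdeg F k T). \<forall>x\<in>interior T. W x = q x) \<and>
        (\<forall>\<tau>\<in>VPoly (jdeg F k T).
           set_lebesgue_integral lebesgue T (\<lambda>x. W x \<bullet> \<tau> x) =
             - set_lebesgue_integral lebesgue T (\<lambda>x. fst v x * divg \<tau> x)
             + (\<Sum>e\<in>F T. face_integral e (\<lambda>x. snd v x * (\<tau> x \<bullet> onormal T e))))))"

definition tnorm :: "'a::euclidean_space set set \<Rightarrow> ('a set \<Rightarrow> 'a set set) \<Rightarrow> nat \<Rightarrow> 'a wfun \<Rightarrow> real" where
  "tnorm Th F k v = sqrt (\<Sum>T\<in>Th. set_lebesgue_integral lebesgue T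
                            (\<lambda>x. wgrad Th F k v x \<bullet> wgrad Th F k v x))"

definition trace_from :: "'a::euclidean_space set \<Rightarrow> ('a \<Rightarrow> real) \<Rightarrow> 'a \<Rightarrow> real" where
  "trace_from T g x = Lim (at x within interior T) g"

definition norm1h :: "'a::euclidean_space set set \<Rightarrow> ('a set \<Rightarrow> 'a set set) \<Rightarrow> 'a wfun \<Rightarrow> real" where
  "norm1h Th F v = sqrt (\<Sum>T\<in>Th.
       set_lebesgue_integral lebesgue T (\<lambda>x. (norm (grad (fst v) x))\<^sup>2)
     + inverse (diameter T) *
         (\<Sum>e\<in>F T. face_integral e (\<lambda>x. (trace_from T (fst v) x - snd v x)\<^sup>2)))"

definition ah :: "('a::euclidean_space \<Rightarrow> real \<Rightarrow> real) \<Rightarrow> 'a set set \<Rightarrow> ('a set \<Rightarrow> 'a set set) \<Rightarrow> nat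
                   \<Rightarrow> 'a wfun \<Rightarrow> 'a wfun \<Rightarrow> 'a wfun \<Rightarrow> real" where
  "ah \<kappa> Th F k w u v = (\<Sum>T\<in>Th. set_lebesgue_integral lebesgue T
       (\<lambda>x. \<kappa> x (norm (wgrad Th F k w x)) * (wgrad Th F k u x \<bullet> wgrad Th F k v x)))"

definition caratheodory :: "'a::euclidean_space set \<Rightarrow> ('a \<Rightarrow> real \<Rightarrow> real) \<Rightarrow> bool" where
  "caratheodory \<Omega> \<kappa> \<longleftrightarrow>
     (\<forall>s\<ge>0. (\<lambda>x. \<kappa> x s) \<in> borel_measurable (lebesgue_on \<Omega>)) \<and>
     (AE x in lebesgue. x \<in> \<Omega> \<longrightarrow> continuous_on {0..} (\<kappa> x))"

definition assumptionA :: "'a::euclidean_space set \<Rightarrow> ('a \<Rightarrow> real \<Rightarrow> real) \<Rightarrow> real \<Rightarrow> real \<Rightarrow> bool" where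
  "assumptionA \<Omega> \<kappa> \<alpha> \<beta> \<longleftrightarrow> caratheodory \<Omega> \<kappa> \<and> 0 < \<alpha> \<and> \<alpha> < \<beta> \<and>
     (AE x in lebesgue. x \<in> \<Omega> \<longrightarrow>
        (\<forall>s t. 0 \<le> s \<and> s \<le> t \<longrightarrow>
           \<alpha> * (t - s) \<le> \<kappa> x t * t - \<kappa> x s * s \<and> \<kappa> x t * t - \<kappa> x s * s \<le> \<beta> * (t - s)))"

end

theory Submission
  imports Defs "HOL-Library.Function_Algebras"
begin

text \<open>The discrete problem is a strongly monotone, Lipschitz continuous equation on the finite-dimensional
  space of weak functions with inner product given by the weak gradients, hence it is solved by a
  contraction (Zarantonello). Monotonicity and the Lipschitz bound are pointwise consequences of the
  growth condition on the flux. The inner product is definite because the norm equivalence forces a weak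
  function with vanishing weak gradient to be constant on every element, with the same constant on its
  faces; a nonzero constant would live on a union of elements whose frontier has codimension two, which
  is impossible for a bounded set with interior points, as almost every line in a given direction avoids
  a set of codimension two.\<close>

section \<open>Strongly monotone equations on finite-dimensional inner product spaces\<close>

text \<open>Weak functions are polynomial only on element interiors and on relative interiors of
  faces, and \<open>wgrad\<close> is a definite description, so existence, uniqueness and linearity
  of the weak gradient precede any use of it. The Riesz theorem behind it is proved for semidefinite
  forms and functionals that vanish on the kernel; no identity theorem for polynomials on an element
  is then called for. The Lipschitz bound is kept in the form \<Lambda> (|u - v|^2 + |w|^2), which
  adds up over elements without a Cauchy-Schwarz inequality for sums; scaling w recovers the usual
  bound. Faces may be nonconvex unions of polytopes, so the volume of the shadow of their relative
  boundary is estimated in place of its dimension. One estimate serves both the prisms that define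
  face integrals and the lines that avoid the skeleton. The pointwise structure on functions makes
  weak functions, as pairs, elements of a \<open>real_vector\<close> type.\<close>

instantiation "fun" :: (type, real_vector) real_vector
begin

definition scaleR_fun_def: "c *\<^sub>R f = (\<lambda>x. c *\<^sub>R f x)"

instance
  by standard (simp_all add: scaleR_fun_def fun_eq_iff scaleR_add_right scaleR_add_left)

end

lemma scaleR_fun_apply [simp]: "(c *\<^sub>R f) x = c *\<^sub>R f x"
  by (simp add: scaleR_fun_def)

lemma sum_fun_apply: "sum f A x = (\<Sum>a\<in>A. f a x)"
  by (induction A rule: infinite_finite_induct) auto

text \<open>Linearity is relative to a set because integrals are additive on integrable integrands,
  which the spaces at hand guarantee and the full function type does not.\<close>

definition linear_on_set :: "'v::real_vector set \<Rightarrow> ('v \<Rightarrow> real) \<Rightarrow> bool" where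
  "linear_on_set V L \<longleftrightarrow> (\<forall>x\<in>V. \<forall>y\<in>V. L (x + y) = L x + L y) \<and> (\<forall>c. \<forall>x\<in>V. L (c *\<^sub>R x) = c * L x)"

lemma linear_on_setI:
  assumes "\<And>x y. x \<in> V \<Longrightarrow> y \<in> V \<Longrightarrow> L (x + y) = L x + L y"
    and "\<And>c x. x \<in> V \<Longrightarrow> L (c *\<^sub>R x) = c * L x"
  shows "linear_on_set V L"
  using assms by (simp add: linear_on_set_def)

lemma linear_on_set_add: "linear_on_set V L \<Longrightarrow> x \<in> V \<Longrightarrow> y \<in> V \<Longrightarrow> L (x + y) = L x + L y"
  and linear_on_set_scale: "linear_on_set V L \<Longrightarrow> x \<in> V \<Longrightarrow> L (c *\<^sub>R x) = c * L x"
  by (simp_all add: linear_on_set_def)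

lemma linear_on_set_diff:
  assumes "linear_on_set V L" "x \<in> V" "y \<in> V" "subspace V"
  shows "L (x - y) = L x - L y"
  using linear_on_set_add[OF assms(1,2), of "(-1) *\<^sub>R y"] linear_on_set_scale[OF assms(1,3), of "-1"] 
    subspace_neg[OF assms(4,3)] by simp

lemma linear_on_set_mono: "linear_on_set V L \<Longrightarrow> W \<subseteq> V \<Longrightarrow> linear_on_set W L"
  unfolding linear_on_set_def by blast

text \<open>A maximal independent subset of V is independent inside \<open>span B\<close>, hence no
  larger than B. A finite set spanning a superspace is thus traded for one spanning V
  itself.\<close>

lemma subspace_finite_span:
  assumes "subspace V" "V \<subseteq> span B" "finite B"
  obtains B' where "finite B'" "span B' = V"
proof -
  obtain B' where B': "B' \<subseteq> V" "independent B'" "V \<subseteq> span B'"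
    using maximal_independent_subset by blast
  have "finite B'"
    using independent_span_bound[OF assms(3) B'(2)] B'(1) assms(2) by blast
  moreover have "span B' = V"
    using B' assms(1) by (simp add: span_minimal subset_antisym)
  ultimately show thesis using that by blast
qed

text \<open>Semidefinite, so that it also covers polynomials on the whole space under the L2 product
  of a single element.\<close>

locale semi_inner =
  fixes V :: "'v::real_vector set" and ip :: "'v \<Rightarrow> 'v \<Rightarrow> real"
  assumes subspace_V: "subspace V"
    and commute: "\<And>x y. x \<in> V \<Longrightarrow> y \<in> V \<Longrightarrow> ip x y = ip y x"
    and linear_left: "\<And>y. y \<in> V \<Longrightarrow> linear_on_set V (\<lambda>x. ip x y)"
    and nonneg: "\<And>x. x \<in> V \<Longrightarrow> 0 \<le> ip x x"
begin

lemmas V_closed = subspace_add[OF subspace_V] subspace_diff[OF subspace_V] subspace_scale[OF subspace_V]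
  subspace_0[OF subspace_V]

lemma linear_right: "x \<in> V \<Longrightarrow> linear_on_set V (ip x)"
  using commute linear_left[of x] V_closed by (simp add: linear_on_set_def)

lemma ip_add: "x \<in> V \<Longrightarrow> y \<in> V \<Longrightarrow> z \<in> V \<Longrightarrow> ip (x + y) z = ip x z + ip y z"
  "x \<in> V \<Longrightarrow> y \<in> V \<Longrightarrow> z \<in> V \<Longrightarrow> ip z (x + y) = ip z x + ip z y"
  using linear_left linear_right by (simp_all add: linear_on_set_def)

lemma ip_scale: "x \<in> V \<Longrightarrow> z \<in> V \<Longrightarrow> ip (c *\<^sub>R x) z = c * ip x z"
  "x \<in> V \<Longrightarrow> z \<in> V \<Longrightarrow> ip z (c *\<^sub>R x) = c * ip z x"
  using linear_left linear_right by (simp_all add: linear_on_set_def)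

lemma ip_diff: "x \<in> V \<Longrightarrow> y \<in> V \<Longrightarrow> z \<in> V \<Longrightarrow> ip (x - y) z = ip x z - ip y z"
  "x \<in> V \<Longrightarrow> y \<in> V \<Longrightarrow> z \<in> V \<Longrightarrow> ip z (x - y) = ip z x - ip z y"
  using linear_on_set_diff[OF linear_left _ _ subspace_V] linear_on_set_diff[OF linear_right _ _ subspace_V] by simp_all

lemmas ip_simps = ip_add ip_scale ip_diff V_closed

lemma ip_zero: "x \<in> V \<Longrightarrow> ip 0 x = 0" "x \<in> V \<Longrightarrow> ip x 0 = 0"
  using ip_scale[OF V_closed(4), of x 0] by simp_all

text \<open>The form at x + t y is a nonnegative polynomial in t. For \<open>ip y y > 0\<close> its
  minimiser gives the claim; for \<open>ip y y = 0\<close> it is affine in t, and a nonzero slope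
  would let it take the value -1.\<close>

lemma Cauchy_Schwarz:
  assumes "x \<in> V" "y \<in> V"
  shows "(ip x y)\<^sup>2 \<le> ip x x * ip y y"
proof -
  have *: "0 \<le> ip x x + 2 * t * ip x y + t\<^sup>2 * ip y y" for t
    using nonneg[of "x + t *\<^sub>R y"] assms commute[OF assms]
    by (simp add: ip_simps algebra_simps power2_eq_square)
  show ?thesis
  proof (cases "ip y y = 0")
    case True
    have "ip x y = 0"
    proof (rule ccontr)
      assume "ip x y \<noteq> 0"
      then show False
        using *[of "- (ip x x + 1) / (2 * ip x y)"] True by (simp add: field_simps)
    qed
    then show ?thesis using True by simp
  next
    case False
    then have "ip y y > 0" using nonneg[OF assms(2)] by simp
    then show ?thesis
      using *[of "- ip x y / ip y y"] by (simp add: field_simps power2_eq_square)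
  qed
qed

lemma ip_kernel: "x \<in> V \<Longrightarrow> y \<in> V \<Longrightarrow> ip x x = 0 \<Longrightarrow> ip x y = 0"
  using Cauchy_Schwarz[of x y] by simp

lemma triangle:
  assumes "x \<in> V" "y \<in> V"
  shows "sqrt (ip (x + y) (x + y)) \<le> sqrt (ip x x) + sqrt (ip y y)"
proof -
  have "\<bar>ip x y\<bar> \<le> sqrt (ip x x) * sqrt (ip y y)"
    using real_sqrt_le_mono[OF Cauchy_Schwarz[OF assms]] by (simp add: real_sqrt_mult)
  then have "ip (x + y) (x + y) \<le> (sqrt (ip x x) + sqrt (ip y y))\<^sup>2"
    using assms nonneg commute[OF assms] by (simp add: ip_simps power2_sum)
  then show ?thesis
    using assms nonneg by (intro real_le_lsqrt) auto
qed

text \<open>Gram-Schmidt by induction on the spanning set. The induction hypothesis is used twice on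
  \<open>span B\<close>: for the functional \<open>ip b\<close>, whose representative p makes q = b
  - p orthogonal to \<open>span B\<close>, and for L. The kernel condition on L takes the place of
  definiteness; \<open>ip b\<close> meets it by Cauchy-Schwarz.\<close>

lemma riesz_span:
  assumes "finite B" "span B \<subseteq> V" "linear_on_set (span B) L"
    and "\<And>x. x \<in> span B \<Longrightarrow> ip x x = 0 \<Longrightarrow> L x = 0"
  shows "\<exists>w\<in>span B. \<forall>x\<in>span B. ip w x = L x"
  using assms
proof (induction B arbitrary: L rule: finite_induct)
  case empty
  have "L 0 = 0" using linear_on_set_scale[OF empty(2), of 0 0] by simp
  then show ?case by (simp add: ip_zero V_closed)
next
  case (insert b B)
  have sub: "span B \<subseteq> span (insert b B)" by (rule span_mono) blast
  have subV: "span B \<subseteq> V" using sub insert.prems(1) by blast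
  have bV: "b \<in> V" using insert.prems(1) span_base[of b "insert b B"] by blast
  have ker: "ip b x = 0" if "x \<in> span B" "ip x x = 0" for x
    using that ip_kernel[OF _ bV, of x] commute[OF bV, of x] subV by auto
  obtain p where p: "p \<in> span B" "\<And>x. x \<in> span B \<Longrightarrow> ip p x = ip b x"
    using insert.IH[OF subV linear_on_set_mono[OF linear_right[OF bV] subV] ker] by blast
  obtain w where w: "w \<in> span B" "\<And>x. x \<in> span B \<Longrightarrow> ip w x = L x"
    using insert.IH[OF subV linear_on_set_mono[OF insert.prems(2) sub]] insert.prems(3) sub
    by blast
  define q where "q = b - p"
  have pV: "p \<in> V" and wV: "w \<in> V" using p w subV by auto
  have qV: "q \<in> V" using bV pV by (simp add: q_def ip_simps)
  have qs: "q \<in> span (insert b B)" using p(1) sub by (auto simp: q_def intro: span_diff span_base)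
  have orth: "ip q x = 0" "ip x q = 0" if "x \<in> span B" for x
    using that p(2)[OF that] subV bV pV qV commute[OF qV, of x] by (auto simp: q_def ip_simps)
  have dec: "\<exists>y\<in>span B. \<exists>c. x = y + c *\<^sub>R q" if x: "x \<in> span (insert b B)" for x
  proof -
    obtain c where "x - c *\<^sub>R b \<in> span B" using x span_breakdown_eq by blast
    then have "x - c *\<^sub>R b + c *\<^sub>R p \<in> span B" using p(1) by (intro span_add span_scale)
    then show ?thesis by (intro bexI exI[of _ c]) (auto simp: q_def algebra_simps)
  qed
  \<comment> \<open>If \<open>ip q q = 0\<close>, the quotient is 0 by convention and L q = 0 by the
    kernel condition, so the formula is right in that case too.\<close>
  define w' where "w' = w + (L q / ip q q) *\<^sub>R q"
  have "w' \<in> span (insert b B)" using w(1) sub qs by (auto simp: w'_def intro: span_add span_scale)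
  moreover have "ip w' x = L x" if x: "x \<in> span (insert b B)" for x
  proof -
    obtain y c where y: "y \<in> span B" "x = y + c *\<^sub>R q" using dec[OF x] by blast
    have yV: "y \<in> V" using y subV by auto
    have "L x = L y + c * L q"
      using insert.prems(2) y sub qs by (simp add: linear_on_set_def span_scale subset_iff)
    moreover have "ip w' x = ip w y + c * (L q / ip q q) * ip q q"
      using y yV wV qV orth w(1) by (simp add: w'_def ip_simps)
    moreover have "ip q q = 0 \<Longrightarrow> L q = 0" using insert.prems(3) qs by blast
    ultimately show ?thesis using w(2)[OF y(1)] by (cases "ip q q = 0") auto
  qed
  ultimately show ?case by blast
qed

text \<open>By Pythagoras, the orthogonal splitting of the Riesz proof turns a Cauchy sequence into
  a Cauchy sequence in \<open>span B\<close> and a scalar sequence weighted by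
  \<open>ip q q\<close>. Convergence is in the seminorm, so the limit need not be unique.\<close>

lemma complete_span:
  assumes "finite B" "span B \<subseteq> V" "\<And>n. \<sigma> n \<in> span B"
    and "\<And>e. e > 0 \<Longrightarrow> \<exists>M. \<forall>m\<ge>M. \<forall>n\<ge>M. ip (\<sigma> m - \<sigma> n) (\<sigma> m - \<sigma> n) < e"
  shows "\<exists>x\<in>span B. (\<lambda>n. ip (\<sigma> n - x) (\<sigma> n - x)) \<longlonglongrightarrow> 0"
  using assms
proof (induction B arbitrary: \<sigma> rule: finite_induct)
  case empty
  then have "\<sigma> n = 0" for n by auto
  then show ?case by (simp add: ip_zero V_closed)
next
  case (insert b B)
  have sub: "span B \<subseteq> span (insert b B)" by (rule span_mono) blast
  have subV: "span B \<subseteq> V" using sub insert.prems(1) by blast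
  have bV: "b \<in> V" using insert.prems(1) span_base[of b "insert b B"] by blast
  have ker: "ip b x = 0" if "x \<in> span B" "ip x x = 0" for x
    using that ip_kernel[OF _ bV, of x] commute[OF bV, of x] subV by auto
  obtain p where p: "p \<in> span B" "\<And>x. x \<in> span B \<Longrightarrow> ip p x = ip b x"
    using riesz_span[OF insert.hyps(1) subV linear_on_set_mono[OF linear_right[OF bV] subV] ker] by blast
  define q where "q = b - p"
  have pV: "p \<in> V" using p subV by auto
  have qV: "q \<in> V" using bV pV by (simp add: q_def ip_simps)
  have qs: "q \<in> span (insert b B)" using p(1) sub by (auto simp: q_def intro: span_diff span_base)
  have orth: "ip q x = 0" "ip x q = 0" if "x \<in> span B" for x
    using that p(2)[OF that] subV bV pV qV commute[OF qV, of x] by (auto simp: q_def ip_simps)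
  have pyth: "ip (y + c *\<^sub>R q) (y + c *\<^sub>R q) = ip y y + c\<^sup>2 * ip q q" if "y \<in> span B" for y c
    using that subV qV orth by (simp add: ip_simps subset_iff power2_eq_square)
  have "\<exists>y c. y \<in> span B \<and> \<sigma> n = y + c *\<^sub>R q" for n
  proof -
    obtain c where "\<sigma> n - c *\<^sub>R b \<in> span B" using insert.prems(2) span_breakdown_eq by blast
    then have "\<sigma> n - c *\<^sub>R b + c *\<^sub>R p \<in> span B" using p(1) by (intro span_add span_scale)
    then show ?thesis by (intro exI[of _ c] exI[of _ "\<sigma> n - c *\<^sub>R b + c *\<^sub>R p"]) (auto simp: q_def algebra_simps)
  qed
  then obtain y c where y: "\<And>n. y n \<in> span B" "\<And>n. \<sigma> n = y n + c n *\<^sub>R q" by metis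
  have dif: "ip (\<sigma> m - \<sigma> n) (\<sigma> m - \<sigma> n) = ip (y m - y n) (y m - y n) + (c m - c n)\<^sup>2 * ip q q" for m n
    using pyth[of "y m - y n" "c m - c n"] y by (simp add: span_diff algebra_simps)
  have yn: "0 \<le> ip (y m - y n) (y m - y n)" for m n
    using y(1) subV by (intro nonneg V_closed) auto
  have qn: "0 \<le> ip q q" using qV nonneg by blast
  have "\<exists>M. \<forall>m\<ge>M. \<forall>n\<ge>M. ip (y m - y n) (y m - y n) < e" if e: "e > 0" for e
  proof -
    obtain M where M: "\<And>m n. m \<ge> M \<Longrightarrow> n \<ge> M \<Longrightarrow> ip (\<sigma> m - \<sigma> n) (\<sigma> m - \<sigma> n) < e"
      using insert.prems(3)[OF e] by blast
    have "ip (y m - y n) (y m - y n) < e" if "m \<ge> M" "n \<ge> M" for m n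
      using M[OF that] mult_nonneg_nonneg[OF zero_le_power2[of "c m - c n"] qn] unfolding dif by linarith
    then show ?thesis by blast
  qed
  then obtain y' where y': "y' \<in> span B" "(\<lambda>n. ip (y n - y') (y n - y')) \<longlonglongrightarrow> 0"
    using insert.IH[OF subV, of y] y(1) by blast
  \<comment> \<open>For \<open>ip q q = 0\<close> the coefficients may diverge, but their
    contribution has seminorm 0 and any \<open>c'\<close> serves; otherwise they form a Cauchy
    sequence of reals.\<close>
  obtain c' where c': "(\<lambda>n. (c n - c')\<^sup>2 * ip q q) \<longlonglongrightarrow> 0"
  proof (cases "ip q q = 0")
    case True
    then show thesis using that[of 0] by simp
  next
    case False
    have "Cauchy c"
    proof (rule CauchyI')
      fix e :: real assume e: "e > 0"
      then obtain M where M: "\<And>m n. m \<ge> M \<Longrightarrow> n \<ge> M \<Longrightarrow> ip (\<sigma> m - \<sigma> n) (\<sigma> m - \<sigma> n) < e\<^sup>2 * ip q q"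
        using insert.prems(3)[of "e\<^sup>2 * ip q q"] False qn by auto
      have "\<bar>c m - c n\<bar> < e" if "m \<ge> M" "n \<ge> M" for m n
      proof -
        have "(c m - c n)\<^sup>2 * ip q q < e\<^sup>2 * ip q q"
          using M[OF that] yn[of m n] unfolding dif by linarith
        then have "(c m - c n)\<^sup>2 < e\<^sup>2" using qn by (simp add: mult_less_cancel_right)
        then show ?thesis using e power2_less_imp_less[of "\<bar>c m - c n\<bar>" e] by simp
      qed
      then show "\<exists>M. \<forall>m\<ge>M. \<forall>n>m. dist (c m) (c n) < e"
        by (intro exI[of _ M]) (auto simp: dist_real_def)
    qed
    then obtain c' where "c \<longlonglongrightarrow> c'" using Cauchy_convergent convergent_def by blast
    then have "(\<lambda>n. (c n - c')\<^sup>2 * ip q q) \<longlonglongrightarrow> (c' - c')\<^sup>2 * ip q q" by (intro tendsto_intros)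
    then show thesis using that by simp
  qed
  have "ip (\<sigma> n - (y' + c' *\<^sub>R q)) (\<sigma> n - (y' + c' *\<^sub>R q)) = ip (y n - y') (y n - y') + (c n - c')\<^sup>2 * ip q q" for n
    using pyth[of "y n - y'" "c n - c'"] y y' by (simp add: span_diff algebra_simps)
  then have "(\<lambda>n. ip (\<sigma> n - (y' + c' *\<^sub>R q)) (\<sigma> n - (y' + c' *\<^sub>R q))) \<longlonglongrightarrow> 0"
    using tendsto_add[OF y'(2) c'] by simp
  moreover have "y' + c' *\<^sub>R q \<in> span (insert b B)"
    using y'(1) sub qs by (auto intro: span_add span_scale)
  ultimately show ?case by blast
qed

end

section \<open>Definite forms: metric completeness and the contraction argument\<close>

locale fin_dim_inner = semi_inner +
  assumes finite_dim: "\<exists>B. finite B \<and> V \<subseteq> span B"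
    and definite: "\<And>x. x \<in> V \<Longrightarrow> ip x x = 0 \<Longrightarrow> x = 0"
begin

text \<open>The value 0 off V is there because \<open>Metric_space\<close> asks for nonnegativity
  and symmetry on the whole type, while the form is controlled on V alone.\<close>

definition dst where "dst x y = (if x \<in> V \<and> y \<in> V then sqrt (ip (x - y) (x - y)) else 0)"

lemma dst_commute: "dst x y = dst y x"
proof -
  have "ip (x - y) (x - y) = ip (y - x) (y - x)" if "x \<in> V" "y \<in> V"
    using that by (simp add: ip_simps)
  then show ?thesis by (simp add: dst_def)
qed

sublocale ms: Metric_space V dst
proof
  show "0 \<le> dst x y" for x y by (auto simp: dst_def V_closed nonneg)
  show "dst x y = dst y x" for x y by (rule dst_commute)
  show "dst x y = 0 \<longleftrightarrow> x = y" if "x \<in> V" "y \<in> V" for x y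
    using that definite[of "x - y"] by (auto simp: dst_def ip_zero V_closed)
  show "dst x z \<le> dst x y + dst y z" if "x \<in> V" "y \<in> V" "z \<in> V" for x y z
    using triangle[of "x - y" "y - z"] that by (simp add: dst_def V_closed)
qed

lemma mcomplete: ms.mcomplete
  unfolding ms.mcomplete_def
proof safe
  fix \<sigma> assume C: "ms.MCauchy \<sigma>"
  then have sV: "\<sigma> n \<in> V" for n by (auto simp: ms.MCauchy_def)
  obtain B where B: "finite B" "span B = V"
    using finite_dim subspace_finite_span[OF subspace_V] by blast
  have "\<exists>M. \<forall>m\<ge>M. \<forall>n\<ge>M. ip (\<sigma> m - \<sigma> n) (\<sigma> m - \<sigma> n) < e" if "e > 0" for e
  proof -
    from C obtain M where "\<And>m n. M \<le> m \<Longrightarrow> M \<le> n \<Longrightarrow> dst (\<sigma> m) (\<sigma> n) < sqrt e"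
      unfolding ms.MCauchy_def using \<open>e > 0\<close> by (meson real_sqrt_gt_zero)
    then show ?thesis using sV by (intro exI[of _ M]) (auto simp: dst_def)
  qed
  then obtain x where x: "x \<in> V" "(\<lambda>n. ip (\<sigma> n - x) (\<sigma> n - x)) \<longlonglongrightarrow> 0"
    using complete_span[OF B(1), of \<sigma>] sV B(2) by auto
  have "(\<lambda>n. dst (\<sigma> n) x) \<longlonglongrightarrow> 0"
    using tendsto_real_sqrt[OF x(2)] sV x(1) by (simp add: dst_def)
  then have "limitin ms.mtopology \<sigma> x sequentially"
    using x(1) sV by (simp add: ms.limit_metric_sequentially lim_sequentially dist_real_def)
  then show "\<exists>x. limitin ms.mtopology \<sigma> x sequentially" by blast
qed

lemma riesz:
  assumes "linear_on_set V L"
  obtains w where "w \<in> V" "\<And>x. x \<in> V \<Longrightarrow> ip w x = L x"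
proof -
  obtain B where B: "finite B" "span B = V"
    using finite_dim subspace_finite_span[OF subspace_V] by blast
  have "L 0 = 0" using linear_on_set_scale[OF assms V_closed(4), of 0] by simp
  then have "\<exists>w\<in>V. \<forall>x\<in>V. ip w x = L x"
    using riesz_span[OF B(1), of L] assms definite B(2) by blast
  then show thesis using that by blast
qed

text \<open>The Riesz representative of the residual is subtracted from the iterate with a small step;
  strong monotonicity makes this a contraction.\<close>

theorem strongly_monotone_unique_solution:
  assumes lin: "\<And>u. u \<in> V \<Longrightarrow> linear_on_set V (N u)" and l: "linear_on_set V l"
    and mono: "\<And>u v. u \<in> V \<Longrightarrow> v \<in> V \<Longrightarrow> \<alpha> * ip (u - v) (u - v) \<le> N u (u - v) - N v (u - v)"
    and lip: "\<And>u v w. u \<in> V \<Longrightarrow> v \<in> V \<Longrightarrow> w \<in> V \<Longrightarrow> N u w - N v w \<le> \<Lambda> * (ip (u - v) (u - v) + ip w w)"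
    and pos: "0 < \<alpha>" "0 < \<Lambda>"
  shows "\<exists>!u. u \<in> V \<and> (\<forall>v\<in>V. N u v = l v)"
proof -
  have "\<exists>w\<in>V. \<forall>x\<in>V. ip w x = N u x - l x" if "u \<in> V" for u
  proof -
    have "linear_on_set V (\<lambda>x. N u x - l x)"
      using lin[OF that] l by (auto simp: linear_on_set_def algebra_simps)
    then show ?thesis using riesz by metis
  qed
  then obtain R where R: "\<And>u. u \<in> V \<Longrightarrow> R u \<in> V"
    and RN: "\<And>u x. u \<in> V \<Longrightarrow> x \<in> V \<Longrightarrow> ip (R u) x = N u x - l x" by metis
  \<comment> \<open>2 \<Lambda> is the Lipschitz constant of R; the summand \<alpha> ensures
    \<alpha> \<le> L and hence \<theta> \<ge> 0. The step \<rho> minimises 1 - 2 \<rho> \<alpha> +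
    \<rho>^2 L^2, and \<theta> is the minimum.\<close>
  define L where "L = 2 * \<Lambda> + \<alpha>"
  define \<rho> where "\<rho> = \<alpha> / L\<^sup>2"
  define \<Phi> where "\<Phi> u = u - \<rho> *\<^sub>R R u" for u
  have L: "L > 0" "L \<ge> \<alpha>" "L \<ge> 2 * \<Lambda>" using pos by (auto simp: L_def)
  have \<rho>: "\<rho> > 0" using L pos by (simp add: \<rho>_def)
  have Rlip: "ip (R u - R v) (R u - R v) \<le> L\<^sup>2 * ip (u - v) (u - v)" if uv: "u \<in> V" "v \<in> V" for u v
  proof -
    define r where "r = R u - R v"
    have rV: "r \<in> V" using uv R by (simp add: r_def V_closed)
    have "ip r r = N u r - N v r"
      using ip_diff(1)[of "R u" "R v" r] RN[OF _ rV] R uv rV by (simp add: r_def)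
    \<comment> \<open>Testing with s r turns the sum of squares in \<open>lip\<close> into a
      Lipschitz bound: (s - \<Lambda> s^2) |r|^2 \<le> \<Lambda> |u - v|^2, and this s maximises the
      left factor, giving |r| \<le> 2 \<Lambda> |u - v|.\<close>
    define s where "s = 1 / (2 * \<Lambda>)"
    have "s * ip r r = N u (s *\<^sub>R r) - N v (s *\<^sub>R r)"
      using \<open>ip r r = _\<close> linear_on_set_scale[OF lin[OF uv(1)] rV] linear_on_set_scale[OF lin[OF uv(2)] rV]
      by (simp add: right_diff_distrib)
    also have "\<dots> \<le> \<Lambda> * (ip (u - v) (u - v) + s * s * ip r r)"
      using lip[OF uv, of "s *\<^sub>R r"] rV by (simp add: ip_simps mult.assoc)
    finally have "ip r r \<le> (2 * \<Lambda>)\<^sup>2 * ip (u - v) (u - v)"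
      using pos by (simp add: s_def field_simps power2_eq_square)
    also have "\<dots> \<le> L\<^sup>2 * ip (u - v) (u - v)"
      using L pos uv by (intro mult_right_mono power_mono nonneg) (auto simp: V_closed)
    finally show ?thesis by (simp add: r_def)
  qed
  define \<theta> where "\<theta> = 1 - \<alpha>\<^sup>2 / L\<^sup>2"
  have \<theta>: "0 \<le> \<theta>" "\<theta> < 1" using L pos by (auto simp: \<theta>_def power_mono)
  have contr: "dst (\<Phi> u) (\<Phi> v) \<le> sqrt \<theta> * dst u v" if uv: "u \<in> V" "v \<in> V" for u v
  proof -
    define d r where "d = u - v" and "r = R u - R v"
    have dV: "d \<in> V" and rV: "r \<in> V" using uv R by (auto simp: d_def r_def V_closed)
    have "ip r d = N u d - N v d"
      using ip_diff(1)[of "R u" "R v" d] RN[OF _ dV] R uv dV by (simp add: r_def)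
    then have rd: "ip r d \<ge> \<alpha> * ip d d" using mono[OF uv] by (simp add: d_def)
    have \<Phi>d: "\<Phi> u - \<Phi> v = d - \<rho> *\<^sub>R r" by (simp add: \<Phi>_def d_def r_def algebra_simps)
    have "ip (\<Phi> u - \<Phi> v) (\<Phi> u - \<Phi> v) = ip d d - 2 * \<rho> * ip r d + \<rho>\<^sup>2 * ip r r"
      unfolding \<Phi>d using dV rV commute[OF dV rV] by (simp add: ip_simps algebra_simps power2_eq_square)
    also have "\<dots> \<le> ip d d - 2 * \<rho> * (\<alpha> * ip d d) + \<rho>\<^sup>2 * (L\<^sup>2 * ip d d)"
      using rd Rlip[OF uv] \<rho> by (intro add_mono diff_mono mult_left_mono) (auto simp: d_def r_def)
    also have "\<dots> = \<theta> * ip d d"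
      using L by (simp add: \<theta>_def \<rho>_def field_simps power2_eq_square)
    finally show ?thesis
      using uv R by (simp add: dst_def V_closed \<Phi>_def d_def flip: real_sqrt_mult)
  qed
  have "V \<noteq> {}" using V_closed(4) by blast
  moreover have "\<Phi> \<in> V \<rightarrow> V" using R by (simp add: \<Phi>_def V_closed)
  moreover have "sqrt \<theta> < 1" using \<theta> by simp
  ultimately obtain u where u: "u \<in> V" "\<Phi> u = u"
    using ms.Banach_fixedpoint_thm[OF mcomplete _ _ _ contr] by blast
  then have "R u = 0" using \<rho> by (auto simp: \<Phi>_def)
  then have "\<forall>v\<in>V. N u v = l v"
    using RN[OF u(1)] linear_on_set_scale[OF linear_left V_closed(4), of _ 0] by auto
  moreover have "u' = u" if "u' \<in> V" "\<forall>v\<in>V. N u' v = l v" for u'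
  proof -
    have "\<alpha> * ip (u' - u) (u' - u) \<le> 0"
      using mono[OF that(1) u(1)] that u(1) \<open>\<forall>v\<in>V. N u v = l v\<close> by (simp add: V_closed)
    then show ?thesis
      using pos nonneg[of "u' - u"] definite[of "u' - u"] that(1) u(1)
      by (simp add: V_closed mult_le_0_iff)
  qed
  ultimately show ?thesis using u(1) by blast
qed

end

section \<open>Polynomials\<close>

lemma linear_image_in_span:
  assumes "linear M" "\<And>s. s \<in> S \<Longrightarrow> M s \<in> span T" "f \<in> span S"
  shows "M f \<in> span T"
proof -
  have "M ` span S = span (M ` S)" using linear_span_image[OF assms(1)] by simp
  also have "\<dots> \<subseteq> span T" using assms(2) by (intro span_minimal) auto
  finally show ?thesis using assms(3) by blast
qed

definition lprods :: "nat \<Rightarrow> ('a::euclidean_space \<Rightarrow> real) set" where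
  "lprods k = {\<lambda>x. \<Prod>i<m. a i \<bullet> x | m a. m \<le> k}"

lemma PolyE:
  assumes "p \<in> Poly k"
  obtains N :: nat and c m a where "\<forall>j<N. m j \<le> k" "p = (\<lambda>x. \<Sum>j<N. c j * (\<Prod>i<m j. a j i \<bullet> x))"
  using assms unfolding Poly_def by (elim CollectE exE conjE) (erule (1) that)

text \<open>The explicit sums of \<open>Poly\<close> are closed under addition only after
  reindexing; as a span the set is a subspace at once.\<close>

lemma Poly_eq_span: "Poly k = span (lprods k)"
proof
  show "Poly k \<subseteq> span (lprods k :: ('a \<Rightarrow> real) set)"
  proof
    fix p :: "'a \<Rightarrow> real" assume "p \<in> Poly k"
    then obtain N :: nat and c m a where m: "\<forall>j<N. m j \<le> k" and p: "p = (\<lambda>x. \<Sum>j<N. c j * (\<Prod>i<m j. a j i \<bullet> x))"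
      by (rule PolyE)
    have "p = (\<Sum>j<N. c j *\<^sub>R (\<lambda>x. \<Prod>i<m j. a j i \<bullet> x))"
      by (simp add: p fun_eq_iff sum_fun_apply)
    moreover have "(\<lambda>x. \<Prod>i<m j. a j i \<bullet> x) \<in> lprods k" if "j < N" for j
      using m that unfolding lprods_def by blast
    ultimately show "p \<in> span (lprods k)"
      by (simp only:) (intro span_sum span_scale span_base, simp)
  qed
  show "span (lprods k) \<subseteq> (Poly k :: ('a \<Rightarrow> real) set)"
  proof
    fix p :: "'a \<Rightarrow> real" assume "p \<in> span (lprods k)"
    then obtain t r where t: "finite t" "t \<subseteq> lprods k" and p: "p = (\<Sum>g\<in>t. r g *\<^sub>R g)"
      unfolding span_explicit by blast
    obtain h where h: "bij_betw h {..<card t} t"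
      using ex_bij_betw_nat_finite[OF t(1)] by (auto simp: atLeast0LessThan)
    have "\<forall>j. \<exists>m a. j < card t \<longrightarrow> m \<le> k \<and> h j = (\<lambda>x. \<Prod>i<m. a i \<bullet> x)"
    proof
      fix j show "\<exists>m a. j < card t \<longrightarrow> m \<le> k \<and> h j = (\<lambda>x. \<Prod>i<m. a i \<bullet> x)"
      proof (cases "j < card t")
        case True
        then have "h j \<in> lprods k" using t(2) h by (auto simp: bij_betw_def)
        then show ?thesis unfolding lprods_def by blast
      qed auto
    qed
    then obtain m a where ma: "\<And>j. j < card t \<Longrightarrow> m j \<le> k \<and> h j = (\<lambda>x. \<Prod>i<m j. a j i \<bullet> x)"
      by metis
    have "p = (\<Sum>j<card t. r (h j) *\<^sub>R h j)"
      unfolding p using sum.reindex_bij_betw[OF h, of "\<lambda>g. r g *\<^sub>R g"] by simp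
    then have "p x = (\<Sum>j<card t. r (h j) * h j x)" for x by (simp add: sum_fun_apply)
    moreover have "(\<Sum>j<card t. r (h j) * h j x) = (\<Sum>j<card t. r (h j) * (\<Prod>i<m j. a j i \<bullet> x))" for x
      using ma by (intro sum.cong refl arg_cong2[where f=times]) simp
    ultimately have "p = (\<lambda>x. \<Sum>j<card t. r (h j) * (\<Prod>i<m j. a j i \<bullet> x))" by (simp add: fun_eq_iff)
    then show "p \<in> Poly k" unfolding Poly_def using ma
      by (intro CollectI exI[of _ "card t"] exI[of _ "\<lambda>j. r (h j)"] exI[of _ m] exI[of _ a]) auto
  qed
qed

lemma subspace_Poly: "subspace (Poly k)"
  by (simp add: Poly_eq_span)

text \<open>The monomials of degree exactly m, built by appending one coordinate at a time so as to
  match the recursion of the products.\<close>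

fun mon_basis :: "nat \<Rightarrow> ('a::euclidean_space \<Rightarrow> real) set" where
  "mon_basis 0 = {\<lambda>x. 1}"
| "mon_basis (Suc m) = (\<lambda>(f, b). \<lambda>x. f x * (b \<bullet> x)) ` (mon_basis m \<times> Basis)"

text \<open>The last linear form is expanded in the coordinates; multiplication by it is a linear
  map, so it suffices to treat the spanning monomials of degree m.\<close>

lemma lprod_in_span:
  fixes a :: "nat \<Rightarrow> 'a::euclidean_space"
  shows "(\<lambda>x. \<Prod>i<m. a i \<bullet> x) \<in> span (mon_basis m)"
proof (induction m)
  case 0
  then show ?case by (simp add: span_base)
next
  case (Suc m)
  have "(\<lambda>x. f x * (a m \<bullet> x)) \<in> span (mon_basis (Suc m))" if f: "f \<in> mon_basis m" for f
  proof -
    have eu: "a m \<bullet> x = (\<Sum>b\<in>Basis. (a m \<bullet> b) * (b \<bullet> x))" for x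
      using euclidean_inner[of "a m" x] by (simp add: inner_commute)
    have "f x * (a m \<bullet> x) = (\<Sum>b\<in>Basis. (a m \<bullet> b) *\<^sub>R (\<lambda>x. f x * (b \<bullet> x))) x" for x
      by (subst eu) (simp add: sum_fun_apply sum_distrib_left mult.left_commute)
    then have "(\<lambda>x. f x * (a m \<bullet> x)) = (\<Sum>b\<in>Basis. (a m \<bullet> b) *\<^sub>R (\<lambda>x. f x * (b \<bullet> x)))"
      by (rule ext)
    also have "\<dots> \<in> span (mon_basis (Suc m))"
    proof (intro span_sum span_scale span_base)
      fix b :: 'a assume "b \<in> Basis"
      then show "(\<lambda>x. f x * (b \<bullet> x)) \<in> mon_basis (Suc m)"
        using f imageI[of "(f, b)" "mon_basis m \<times> Basis" "\<lambda>(f, b) x. f x * (b \<bullet> x)"] by simp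
    qed
    finally show ?thesis .
  qed
  moreover have "linear (\<lambda>(f :: 'a \<Rightarrow> real) x. f x * (a m \<bullet> x))"
    by (rule linearI) (simp_all add: fun_eq_iff distrib_right)
  ultimately have "(\<lambda>x. (\<Prod>i<m. a i \<bullet> x) * (a m \<bullet> x)) \<in> span (mon_basis (Suc m))"
    using linear_image_in_span[of "\<lambda>f x. f x * (a m \<bullet> x)" "mon_basis m" "mon_basis (Suc m)", OF _ _ Suc] by blast
  then show ?case by (simp only: prod.lessThan_Suc)
qed

lemma finite_mon_basis: "finite (mon_basis m)"
  by (induction m) auto

lemma Poly_finite_dim: "\<exists>B. finite B \<and> (Poly k :: ('a::euclidean_space \<Rightarrow> real) set) \<subseteq> span B"
proof (intro exI conjI)
  show "finite (\<Union>m\<le>k. mon_basis m)" by (simp add: finite_mon_basis)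
  show "(Poly k :: ('a \<Rightarrow> real) set) \<subseteq> span (\<Union>m\<le>k. mon_basis m)"
    unfolding Poly_eq_span
  proof (rule span_minimal, rule subsetI)
    fix p :: "'a \<Rightarrow> real" assume "p \<in> lprods k"
    then obtain m a where "m \<le> k" and p: "p = (\<lambda>x. \<Prod>i<m. a i \<bullet> x)" by (auto simp: lprods_def)
    then have "span (mon_basis m) \<subseteq> span (\<Union>m\<le>k. mon_basis m :: ('a \<Rightarrow> real) set)" by (intro span_mono) auto
    then show "p \<in> span (\<Union>m\<le>k. mon_basis m)" using lprod_in_span[where m=m and a=a] p by blast
  qed auto
qed

lemma subspace_VPoly: "subspace (VPoly k :: ('a::euclidean_space \<Rightarrow> 'a) set)"
proof (rule subspaceI)
  have P0: "(\<lambda>x. 0) \<in> Poly k"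
    using subspace_0[OF subspace_Poly] by (simp only: zero_fun_def)
  show "0 \<in> VPoly k" unfolding VPoly_def by (simp add: P0)
next
  fix \<sigma> \<tau> :: "'a \<Rightarrow> 'a" and c :: real
  assume s: "\<sigma> \<in> VPoly k"
  show "c *\<^sub>R \<sigma> \<in> VPoly k"
    unfolding VPoly_def
  proof safe
    fix b :: 'a assume "b \<in> Basis"
    then have "c *\<^sub>R (\<lambda>x. \<sigma> x \<bullet> b) \<in> Poly k"
      using s by (intro subspace_scale[OF subspace_Poly]) (simp add: VPoly_def)
    then show "(\<lambda>x. (c *\<^sub>R \<sigma>) x \<bullet> b) \<in> Poly k" by (simp add: scaleR_fun_def)
  qed
  assume t: "\<tau> \<in> VPoly k"
  show "\<sigma> + \<tau> \<in> VPoly k"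
    unfolding VPoly_def
  proof safe
    fix b :: 'a assume "b \<in> Basis"
    then have "(\<lambda>x. \<sigma> x \<bullet> b) + (\<lambda>x. \<tau> x \<bullet> b) \<in> Poly k"
      using s t by (intro subspace_add[OF subspace_Poly]) (simp_all add: VPoly_def)
    then show "(\<lambda>x. (\<sigma> + \<tau>) x \<bullet> b) \<in> Poly k" by (simp add: plus_fun_def inner_add_left)
  qed
qed

lemma VPoly_finite_dim: "\<exists>B. finite B \<and> (VPoly k :: ('a::euclidean_space \<Rightarrow> 'a) set) \<subseteq> span B"
proof -
  obtain B where B: "finite B" "(Poly k :: ('a \<Rightarrow> real) set) \<subseteq> span B" using Poly_finite_dim by blast
  let ?B = "\<Union>b\<in>Basis. (\<lambda>f x. f x *\<^sub>R (b::'a)) ` B"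
  have "\<tau> \<in> span ?B" if "\<tau> \<in> VPoly k" for \<tau>
  proof -
    have "\<tau> = (\<Sum>b\<in>Basis. (\<lambda>x. (\<tau> x \<bullet> b) *\<^sub>R b))"
      by (simp add: fun_eq_iff sum_fun_apply euclidean_representation)
    also have "\<dots> \<in> span ?B"
    proof (rule span_sum)
      fix b :: 'a assume b: "b \<in> Basis"
      then have "(\<lambda>x. \<tau> x \<bullet> b) \<in> span B" using that B(2) by (auto simp: VPoly_def)
      moreover have "linear (\<lambda>(f :: 'a \<Rightarrow> real) x. f x *\<^sub>R b)"
        by (rule linearI) (simp_all add: fun_eq_iff scaleR_add_left)
      moreover have "(\<lambda>x. f x *\<^sub>R b) \<in> span ?B" if "f \<in> B" for f
        using that b by (intro span_base) blast
      ultimately show "(\<lambda>x. (\<tau> x \<bullet> b) *\<^sub>R b) \<in> span ?B"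
        using linear_image_in_span[of "\<lambda>f x. f x *\<^sub>R b" B ?B "\<lambda>x. \<tau> x \<bullet> b"] by simp
    qed
    finally show ?thesis .
  qed
  then show ?thesis using B(1) by (intro exI[of _ ?B]) auto
qed

text \<open>Continuity of D x h in x for each fixed h stands in for continuity of D in the operator
  norm; in finite dimension the two agree, and gradient and divergence evaluate D on basis
  vectors.\<close>

definition C1 :: "('a::real_normed_vector \<Rightarrow> 'b::real_normed_vector) \<Rightarrow> bool" where
  "C1 f \<longleftrightarrow> (\<exists>D. (\<forall>x. (f has_derivative D x) (at x)) \<and> (\<forall>h. continuous_on UNIV (\<lambda>x. D x h)))"

lemma C1_continuous: "C1 f \<Longrightarrow> continuous_on S f"
  unfolding C1_def by (meson continuous_at_imp_continuous_on has_derivative_continuous)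

lemma C1_has_derivative: "C1 f \<Longrightarrow> (f has_derivative frechet_derivative f (at x)) (at x)"
  unfolding C1_def using frechet_derivative_at by metis

lemma C1_continuous_derivative: "C1 f \<Longrightarrow> continuous_on S (\<lambda>x. frechet_derivative f (at x) h)"
proof -
  assume "C1 f"
  then obtain D where D: "\<And>x. (f has_derivative D x) (at x)" "\<And>h. continuous_on UNIV (\<lambda>x. D x h)"
    unfolding C1_def by blast
  then have "D x = frechet_derivative f (at x)" for x
    using frechet_derivative_at by blast
  then show ?thesis using continuous_on_subset[OF D(2)[of h] subset_UNIV] by simp
qed

lemma C1_const: "C1 (\<lambda>x. c)"
  unfolding C1_def by (intro exI[of _ "\<lambda>x h. 0"]) auto

lemma C1_inner: "C1 (\<lambda>x. a \<bullet> x)"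
  unfolding C1_def by (intro exI[of _ "\<lambda>x h. a \<bullet> h"]) (auto intro!: derivative_eq_intros)

lemma C1_add: "C1 f \<Longrightarrow> C1 g \<Longrightarrow> C1 (\<lambda>x. f x + g x)"
  unfolding C1_def by (elim exE conjE, rule_tac x="\<lambda>x h. D x h + Da x h" in exI)
    (auto intro!: derivative_eq_intros continuous_intros)

lemma C1_sum: "(\<And>i. i \<in> A \<Longrightarrow> C1 (f i)) \<Longrightarrow> C1 (\<lambda>x. \<Sum>i\<in>A. f i x)"
  by (induction A rule: infinite_finite_induct) (auto intro: C1_const C1_add)

lemma C1_mult:
  fixes f g :: "'a::real_normed_vector \<Rightarrow> real"
  assumes "C1 f" "C1 g"
  shows "C1 (\<lambda>x. f x * g x)"
proof -
  from assms obtain D E where "\<And>x. (f has_derivative D x) (at x)" "\<And>h. continuous_on UNIV (\<lambda>x. D x h)"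
    "\<And>x. (g has_derivative E x) (at x)" "\<And>h. continuous_on UNIV (\<lambda>x. E x h)"
    unfolding C1_def by blast
  then show ?thesis unfolding C1_def
    by (intro exI[of _ "\<lambda>x h. f x * E x h + D x h * g x"])
      (auto intro!: has_derivative_mult continuous_intros C1_continuous[OF assms(1)] C1_continuous[OF assms(2)])
qed

lemma C1_scaleR: 
  assumes "C1 f"
  shows "C1 (\<lambda>x. f x *\<^sub>R b)"
proof -
  from assms obtain D where "\<And>x. (f has_derivative D x) (at x)" "\<And>h. continuous_on UNIV (\<lambda>x. D x h)"
    unfolding C1_def by blast
  then show ?thesis unfolding C1_def
    by (intro exI[of _ "\<lambda>x h. D x h *\<^sub>R b"])
      (auto intro!: has_derivative_scaleR_left continuous_intros)
qed

lemma Poly_C1: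
  assumes "p \<in> Poly k"
  shows "C1 p"
proof -
  from assms obtain N :: nat and c m a where "\<forall>j<N. m j \<le> k" and p: "p = (\<lambda>x. \<Sum>j<N. c j * (\<Prod>i<m j. a j i \<bullet> x))"
    by (rule PolyE)
  have "C1 (\<lambda>x. \<Prod>i<m. (a i :: 'a) \<bullet> x)" for m :: nat and a
    by (induction m) (auto intro: C1_const C1_mult C1_inner)
  then show ?thesis unfolding p by (intro C1_sum C1_mult C1_const)
qed

lemma VPoly_C1:
  assumes "\<tau> \<in> VPoly k"
  shows "C1 \<tau>"
proof -
  have "C1 (\<lambda>x. \<Sum>b\<in>Basis. (\<tau> x \<bullet> b) *\<^sub>R b)"
    using assms by (intro C1_sum C1_scaleR) (auto simp: VPoly_def intro: Poly_C1)
  then show ?thesis by (simp add: euclidean_representation)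
qed

lemma C1_continuous_grad: "C1 p \<Longrightarrow> continuous_on S (grad p)"
  unfolding grad_def by (intro continuous_intros C1_continuous_derivative)

lemma C1_continuous_divg: "C1 \<tau> \<Longrightarrow> continuous_on S (divg \<tau>)"
  unfolding divg_def by (intro continuous_intros C1_continuous_derivative)

lemma divg_add:
  assumes "C1 \<sigma>" "C1 \<tau>"
  shows "divg (\<sigma> + \<tau>) x = divg \<sigma> x + divg \<tau> x"
proof -
  have "((\<sigma> + \<tau>) has_derivative (\<lambda>h. frechet_derivative \<sigma> (at x) h + frechet_derivative \<tau> (at x) h)) (at x)"
    unfolding plus_fun_def by (intro has_derivative_add C1_has_derivative assms)
  from frechet_derivative_at[OF this, symmetric] show ?thesis
    by (simp add: divg_def inner_add_left sum.distrib)
qed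

lemma divg_scale:
  assumes "C1 \<tau>"
  shows "divg (c *\<^sub>R \<tau>) x = c * divg \<tau> x"
proof -
  have "((c *\<^sub>R \<tau>) has_derivative (\<lambda>h. c *\<^sub>R frechet_derivative \<tau> (at x) h)) (at x)"
    unfolding scaleR_fun_def by (intro has_derivative_scaleR_right C1_has_derivative assms)
  from frechet_derivative_at[OF this, symmetric] show ?thesis
    by (simp add: divg_def sum_distrib_left)
qed

text \<open>Weak functions are polynomial on open interiors and cut off elsewhere; agreement on an
  open neighbourhood already fixes the derivative.\<close>

lemma frechet_derivative_cong_open:
  assumes "C1 p" "open S" "x \<in> S" "\<And>y. y \<in> S \<Longrightarrow> g y = p y"
  shows "frechet_derivative g (at x) = frechet_derivative p (at x)"
proof -
  have "(g has_derivative frechet_derivative p (at x)) (at x)"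
    by (rule has_derivative_transform_within_open[OF C1_has_derivative[OF assms(1)] assms(2,3)]) (simp add: assms(4))
  then show ?thesis by (rule frechet_derivative_at[symmetric])
qed

lemma divg_eq_0_open:
  assumes "open S" "x \<in> S" "\<And>y. y \<in> S \<Longrightarrow> \<tau> y = 0"
  shows "divg \<tau> x = 0"
  using frechet_derivative_cong_open[OF C1_const assms(1,2), of \<tau> 0] assms(3) by (simp add: divg_def)

lemma grad_cong_open:
  assumes "C1 p" "open S" "x \<in> S" "\<And>y. y \<in> S \<Longrightarrow> g y = p y"
  shows "grad g x = grad p x"
  using frechet_derivative_cong_open[OF assms] by (simp add: grad_def)

text \<open>The components of the gradient are the derivative on basis vectors, so by linearity the
  whole derivative vanishes, and connectedness does the rest.\<close>

lemma grad_0_imp_constant: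
  assumes "C1 p" "open S" "connected S" "\<And>x. x \<in> S \<Longrightarrow> grad p x = 0"
  obtains c where "\<And>x. x \<in> S \<Longrightarrow> p x = c"
proof -
  have "(p has_derivative (\<lambda>h. 0)) (at x)" if "x \<in> S" for x
  proof -
    have "frechet_derivative p (at x) b = 0" if "b \<in> Basis" for b
      using arg_cong[OF assms(4)[OF \<open>x \<in> S\<close>], of "\<lambda>v. v \<bullet> b"] that
      by (simp add: grad_def inner_sum_left inner_Basis if_distrib sum.delta cong: if_cong)
    moreover have "linear (frechet_derivative p (at x))"
      using C1_has_derivative[OF assms(1)] has_derivative_linear by blast
    ultimately have "frechet_derivative p (at x) = (\<lambda>h. 0)"
      by (intro linear_eq_stdbasis) (auto intro: linear_zero)
    then show ?thesis using C1_has_derivative[OF assms(1), of x] by simp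
  qed
  then show thesis
    using has_derivative_zero_unique_connected[OF assms(2,3)] that by metis
qed

section \<open>Face integrals\<close>

text \<open>Lebesgue measure is complete, so agreement off a null set makes g measurable; equality
  of the values is taken over from the gauge integral.\<close>

lemma set_lebesgue_integral_spike:
  fixes f g :: "'a::euclidean_space \<Rightarrow> 'b::euclidean_space"
  assumes f: "f absolutely_integrable_on S" and N: "negligible N" "\<And>x. x \<in> S - N \<Longrightarrow> g x = f x"
  shows "g absolutely_integrable_on S"
    and "set_lebesgue_integral lebesgue S g = set_lebesgue_integral lebesgue S f"
proof -
  show g: "g absolutely_integrable_on S"
    using absolutely_integrable_spike[OF f N] .
  show "set_lebesgue_integral lebesgue S g = set_lebesgue_integral lebesgue S f"
    using set_lebesgue_integral_eq_integral(2)[OF f] set_lebesgue_integral_eq_integral(2)[OF g]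
      integral_spike[of N S g f] N by simp
qed

lemma absolutely_integrable_continuous_compact:
  fixes f :: "'a::euclidean_space \<Rightarrow> 'b::euclidean_space"
  assumes "compact S" "continuous_on S f"
  shows "f absolutely_integrable_on S"
proof -
  have "integrable lborel (\<lambda>x. indicator S x *\<^sub>R f x)"
    using borel_integrable_compact[OF assms] .
  then show ?thesis
    unfolding set_integrable_def using integrable_completion[OF borel_measurable_integrable] by blast
qed

text \<open>A nonnegative function with zero integral vanishes almost everywhere, whereas by
  continuity a nonzero value in U would persist on a nonempty open set, which is not null.\<close>

lemma set_lebesgue_integral_nonneg_eq_0:
  fixes f :: "'a::euclidean_space \<Rightarrow> real"
  assumes "f absolutely_integrable_on S" "\<And>x. x \<in> S \<Longrightarrow> 0 \<le> f x"
    and "set_lebesgue_integral lebesgue S f = 0"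
    and "open U" "U \<subseteq> S" "continuous_on U f" "x \<in> U"
  shows "f x = 0"
proof (rule ccontr)
  assume "f x \<noteq> 0"
  let ?N = "U \<inter> f -` (- {0})"
  have ae: "AE x in lebesgue. indicator S x *\<^sub>R f x = 0"
    using integral_nonneg_eq_0_iff_AE[of lebesgue "\<lambda>x. indicator S x *\<^sub>R f x"] assms(1-3)
    by (auto simp: set_integrable_def set_lebesgue_integral_def indicator_def)
  have op: "open ?N" using assms(4,6) by (intro continuous_open_preimage) auto
  have "AE x in lebesgue. x \<notin> ?N"
    using ae by eventually_elim (use assms(5) in \<open>auto simp: indicator_def split: if_splits\<close>)
  then have "?N \<in> null_sets lebesgue"
    using op by (subst AE_iff_null_sets) auto
  then have "negligible ?N" by (simp add: negligible_iff_null_sets)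
  then show False using open_not_negligible[OF op] \<open>x \<in> U\<close> \<open>f x \<noteq> 0\<close> by blast
qed

lemma inner_diff_eq_0_iff: "(x - y) \<bullet> \<nu> = 0 \<longleftrightarrow> \<nu> \<bullet> x = \<nu> \<bullet> y" for x :: "'a::real_inner"
  by (simp add: inner_diff_left inner_commute[of \<nu>])

lemma normal_toD: "normal_to e \<nu> \<Longrightarrow> x \<in> e \<Longrightarrow> y \<in> e \<Longrightarrow> \<nu> \<bullet> x = \<nu> \<bullet> y"
  unfolding normal_to_def using inner_diff_eq_0_iff by blast

lemma normal_to_affine_hull_subset:
  assumes "normal_to e \<nu>" "y \<in> affine hull e" "z \<in> affine hull e"
  shows "(y - z) \<bullet> \<nu> = 0"
proof (cases "e = {}")
  case False
  then obtain a where a: "a \<in> e" by blast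
  have "affine hull e \<subseteq> {x. \<nu> \<bullet> x = \<nu> \<bullet> a}"
    using normal_toD[OF assms(1) _ a] affine_hyperplane by (intro hull_minimal) auto
  then show ?thesis using assms by (auto simp: inner_diff_eq_0_iff subset_iff)
qed (use assms in auto)

text \<open>Codimension one makes the affine hull fill the hyperplane through z: one affine set lies
  in the other and their dimensions agree.\<close>

lemma normal_to_affine_hull:
  fixes e :: "'a::euclidean_space set"
  assumes "normal_to e \<nu>" "aff_dim e = int DIM('a) - 1" "z \<in> affine hull e" "(y - z) \<bullet> \<nu> = 0"
  shows "y \<in> affine hull e"
proof -
  have "\<nu> \<noteq> 0" using assms(1) by (auto simp: normal_to_def)
  have "affine hull e = {x. \<nu> \<bullet> x = \<nu> \<bullet> z}"
  proof (rule affine_dim_equal)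
    show "affine hull e \<subseteq> {x. \<nu> \<bullet> x = \<nu> \<bullet> z}"
      using normal_to_affine_hull_subset[OF assms(1) _ assms(3)] by (auto simp: inner_diff_eq_0_iff)
  qed (use assms \<open>\<nu> \<noteq> 0\<close> in \<open>auto simp: affine_hyperplane aff_dim_hyperplane\<close>)
  then show ?thesis using assms(4) by (auto simp: inner_diff_eq_0_iff)
qed

lemma negligible_normal_to:
  assumes "normal_to e \<nu>"
  shows "negligible e"
proof (cases "e = {}")
  case False
  then obtain a where "a \<in> e" by blast
  then have "e \<subseteq> {x. \<nu> \<bullet> x = \<nu> \<bullet> a}"
    using normal_toD[OF assms _ \<open>a \<in> e\<close>] by blast
  moreover have "\<nu> \<noteq> 0" using assms by (auto simp: normal_to_def)
  ultimately show ?thesis using negligible_hyperplane negligible_subset by blast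
qed simp

text \<open>Over each convex piece P of the face, a point above the relative boundary of the face cannot
  be interior to the convex prism over P, so the shadow is covered by frontiers of convex sets.\<close>

lemma negligible_rel_boundary_shadow:
  fixes e :: "'a::euclidean_space set"
  assumes "flat_face e" "normal_to e \<nu>"
  shows "negligible {y + t *\<^sub>R b | y t. y \<in> e - rel_interior e \<and> 0 \<le> t \<and> t \<le> R}"
proof (cases "b \<bullet> \<nu> = 0")
  case True
  show ?thesis
  proof (cases "e = {}")
    case False
    then obtain a where a: "a \<in> e" by blast
    have "\<nu> \<bullet> (y + t *\<^sub>R b) = \<nu> \<bullet> a" if "y \<in> e" for y t
      using normal_toD[OF assms(2) that a] True by (simp add: inner_add_right inner_commute)
    then have "{y + t *\<^sub>R b | y t. y \<in> e - rel_interior e \<and> 0 \<le> t \<and> t \<le> R} \<subseteq> {x. \<nu> \<bullet> x = \<nu> \<bullet> a}"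
      by auto
    moreover have "\<nu> \<noteq> 0" using assms(2) by (auto simp: normal_to_def)
    ultimately show ?thesis using negligible_hyperplane negligible_subset by blast
  qed simp
next
  case False
  obtain S where S: "finite S" "\<And>P. P \<in> S \<Longrightarrow> polytope P" "e = \<Union>S"
    using assms(1) unfolding flat_face_def by blast
  define K where "K P = (\<lambda>(y, t). y + t *\<^sub>R b) ` (P \<times> {0..R})" for P
  have convK: "convex (K P)" if "P \<in> S" for P
    unfolding K_def using S(2)[OF that] polytope_imp_convex
    by (intro convex_linear_image convex_Times) (auto intro!: linearI simp: algebra_simps)
  have "{y + t *\<^sub>R b | y t. y \<in> e - rel_interior e \<and> 0 \<le> t \<and> t \<le> R} \<subseteq> (\<Union>P\<in>S. frontier (K P))"
  proof safe
    fix y t assume y: "y \<in> e" "y \<notin> rel_interior e" and t: "0 \<le> t" "t \<le> R"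
    obtain P where P: "P \<in> S" "y \<in> P" using y(1) S(3) by blast
    have yK: "y + t *\<^sub>R b \<in> K P" using P t unfolding K_def by force
    have "y + t *\<^sub>R b \<notin> interior (K P)"
    proof
      assume "y + t *\<^sub>R b \<in> interior (K P)"
      then obtain r where r: "r > 0" "ball (y + t *\<^sub>R b) r \<subseteq> K P"
        using mem_interior by blast
      \<comment> \<open>A point z of the plane of e near y is lifted by t b into \<open>K P\<close>,
        over some foot y' in P. Both z and y' lie in that plane and differ by a multiple of b, which
        is transversal to it, so z = y'.\<close>
      have "ball y r \<inter> affine hull e \<subseteq> e"
      proof safe
        fix z assume z: "z \<in> ball y r" "z \<in> affine hull e"
        have "z + t *\<^sub>R b \<in> ball (y + t *\<^sub>R b) r" using z(1) by (simp add: dist_norm)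
        then have "z + t *\<^sub>R b \<in> K P" using r(2) by blast
        then obtain y' t' where y': "y' \<in> P" "z + t *\<^sub>R b = y' + t' *\<^sub>R b"
          unfolding K_def by auto
        have "y' \<in> e" using y' P S(3) by blast
        then have "(z - y') \<bullet> \<nu> = 0"
          using normal_to_affine_hull_subset[OF assms(2) z(2)] hull_inc by metis
        moreover have "z - y' = (t' - t) *\<^sub>R b" using y'(2) by (simp add: algebra_simps)
        ultimately have "z = y'" using False by simp
        then show "z \<in> e" using \<open>y' \<in> e\<close> by simp
      qed
      then have "y \<in> rel_interior e" using y(1) r(1) mem_rel_interior_ball by blast
      then show False using y(2) by simp
    qed
    then show "y + t *\<^sub>R b \<in> (\<Union>P\<in>S. frontier (K P))"
      using P(1) yK closure_subset by (auto simp: frontier_def)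
  qed
  moreover have "negligible (\<Union>P\<in>S. frontier (K P))"
    using S(1) convK by (intro negligible_Union) (auto intro: negligible_convex_frontier)
  ultimately show ?thesis using negligible_subset by blast
qed

lemma compact_flat_face: "flat_face e \<Longrightarrow> compact e"
  unfolding flat_face_def by (metis compact_Union polytope_imp_compact)

text \<open>An empty relative interior would make e empty, of affine dimension -1, and the space
  zero-dimensional. The point so found is where the values on two elements sharing a face are
  compared.\<close>

lemma flat_face_rel_interior_nonempty:
  fixes e :: "'a::euclidean_space set"
  assumes "flat_face e"
  shows "rel_interior e \<noteq> {}"
proof
  assume "rel_interior e = {}"
  then have cl: "closure (rel_interior e) = {}" by (simp only: closure_empty)
  have e: "e = closure (rel_interior e)"
    using assms unfolding flat_face_def by (elim conjE)
  have e2: "aff_dim e = int DIM('a) - 1"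
    using assms unfolding flat_face_def by (elim conjE)
  have "e = {}" using e cl by (rule trans)
  then have "int DIM('a) = 0" using e2 by simp
  then show False by simp
qed

text \<open>K is the unit prism over the face, \<pi> the projection onto its plane, N the part of K
  over the relative boundary. Integrands then matter on the relative interior alone; interior points
  of K lie over each of its points, which lets a vanishing integral yield pointwise
  vanishing.\<close>

lemma face_integral_prism:
  fixes e :: "'a::euclidean_space set"
  assumes e: "flat_face e" "\<exists>\<nu>. normal_to e \<nu>"
  obtains K N and \<pi> :: "'a \<Rightarrow> 'a" where "compact K" "continuous_on UNIV \<pi>" "negligible N"
    "\<And>x. x \<in> K - N \<Longrightarrow> \<pi> x \<in> rel_interior e"
    "\<And>y. y \<in> rel_interior e \<Longrightarrow> \<exists>x\<in>interior K. \<pi> x = y"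
    "\<And>g. face_integral e g = set_lebesgue_integral lebesgue K (\<lambda>x. g (\<pi> x))"
proof -
  define \<nu> where "\<nu> = (SOME \<nu>. normal_to e \<nu>)"
  define z where "z = (SOME z. z \<in> e)"
  define K where "K = {y + t *\<^sub>R \<nu> | y t. y \<in> e \<and> 0 \<le> t \<and> t \<le> 1}"
  define N where "N = {y + t *\<^sub>R \<nu> | y t. y \<in> e - rel_interior e \<and> 0 \<le> t \<and> t \<le> 1}"
  define \<pi> where "\<pi> x = x - ((x - z) \<bullet> \<nu>) *\<^sub>R \<nu>" for x
  have nu: "normal_to e \<nu>" unfolding \<nu>_def using e(2) by (rule someI_ex)
  have n1: "\<nu> \<bullet> \<nu> = 1" using nu by (simp add: normal_to_def dot_square_norm)
  have ad: "aff_dim e = int DIM('a) - 1" using e(1) unfolding flat_face_def by (elim conjE)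
  have "e \<noteq> {}" using flat_face_rel_interior_nonempty[OF e(1)] rel_interior_subset by blast
  then have z: "z \<in> e" unfolding z_def by (simp add: some_in_eq)
  have \<pi>: "\<pi> (y + t *\<^sub>R \<nu>) = y" if "y \<in> e" for y t
  proof -
    have "(y - z) \<bullet> \<nu> = 0" using nu that z by (simp add: normal_to_def)
    then have "(y + t *\<^sub>R \<nu> - z) \<bullet> \<nu> = t" using n1 by (simp add: algebra_simps)
    then show ?thesis by (simp add: \<pi>_def)
  qed
  show thesis
  proof (rule that[of K \<pi> N])
    have "K = (\<lambda>(y, t). y + t *\<^sub>R \<nu>) ` (e \<times> {0..1})" by (fastforce simp: K_def image_iff)
    moreover have "compact \<dots>"
      using compact_flat_face[OF e(1)]
      by (intro compact_continuous_image compact_Times) (auto intro!: continuous_intros simp: split_def)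
    ultimately show "compact K" by simp
    show "continuous_on UNIV \<pi>" unfolding \<pi>_def by (intro continuous_intros)
    show "negligible N" unfolding N_def using negligible_rel_boundary_shadow[OF e(1) nu] .
    show "\<pi> x \<in> rel_interior e" if xK: "x \<in> K - N" for x
    proof -
      obtain y t where x: "x = y + t *\<^sub>R \<nu>" "y \<in> e" "0 \<le> t" "t \<le> 1" using xK unfolding K_def by blast
      then have "y \<in> rel_interior e" using xK unfolding N_def by blast
      then show ?thesis using \<pi>[OF x(2)] x(1) by simp
    qed
    show "face_integral e g = set_lebesgue_integral lebesgue K (\<lambda>x. g (\<pi> x))" for g
      by (simp add: face_integral_def Let_def K_def \<pi>_def \<nu>_def z_def)
    show "\<exists>x\<in>interior K. \<pi> x = y" if y: "y \<in> rel_interior e" for y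
    proof (intro bexI)
      have ye: "y \<in> e" using y rel_interior_subset by blast
      show "\<pi> (y + (1/2) *\<^sub>R \<nu>) = y" using \<pi>[OF ye] .
      obtain r where r: "r > 0" "ball y r \<inter> affine hull e \<subseteq> e"
        using y mem_rel_interior_ball by blast
      \<comment> \<open>The point over y at half height has room 1/2 in the normal direction and r
        in the plane: a perturbation u splits into its normal part and its tangential part v, whose
        norm does not exceed that of u.\<close>
      have "ball (y + (1/2) *\<^sub>R \<nu>) (min r (1/2)) \<subseteq> K"
      proof
        fix w assume w: "w \<in> ball (y + (1/2) *\<^sub>R \<nu>) (min r (1/2))"
        define u where "u = w - (y + (1/2) *\<^sub>R \<nu>)"
        define v where "v = u - (u \<bullet> \<nu>) *\<^sub>R \<nu>"
        have un: "norm u < r" "norm u < 1/2" using w by (auto simp: u_def dist_norm norm_minus_commute)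
        have "\<bar>u \<bullet> \<nu>\<bar> \<le> norm u" using Cauchy_Schwarz_ineq2[of u \<nu>] nu by (simp add: normal_to_def)
        have "v \<bullet> v = u \<bullet> u - (u \<bullet> \<nu>)\<^sup>2"
          using n1 by (simp add: v_def algebra_simps power2_eq_square inner_commute)
        then have "norm v \<le> norm u" by (simp add: norm_le)
        have vn: "v \<bullet> \<nu> = 0" using n1 by (simp add: v_def algebra_simps)
        have "y + v \<in> ball y r" using \<open>norm v \<le> norm u\<close> un by (simp add: dist_norm)
        moreover have "y + v \<in> affine hull e"
          using normal_to_affine_hull[OF nu ad hull_inc[OF ye], of "y + v"] vn by simp
        ultimately have "y + v \<in> e" using r(2) by blast
        moreover have "w = (y + v) + (1/2 + u \<bullet> \<nu>) *\<^sub>R \<nu>" by (simp add: v_def u_def algebra_simps)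
        moreover have "0 \<le> 1/2 + u \<bullet> \<nu>" "1/2 + u \<bullet> \<nu> \<le> 1" using \<open>\<bar>u \<bullet> \<nu>\<bar> \<le> norm u\<close> un by linarith+
        ultimately show "w \<in> K" unfolding K_def by blast
      qed
      then show "y + (1/2) *\<^sub>R \<nu> \<in> interior K"
        using r(1) by (intro interiorI[of "ball (y + (1/2) *\<^sub>R \<nu>) (min r (1/2))"]) auto
    qed
  qed
qed

text \<open>Only the relative interior of a face is visible to the face integral.\<close>

definition cont_on_face :: "'a::euclidean_space set \<Rightarrow> ('a \<Rightarrow> real) \<Rightarrow> bool" where
  "cont_on_face e g \<longleftrightarrow> (\<exists>p. continuous_on UNIV p \<and> (\<forall>x\<in>rel_interior e. g x = p x))"

lemma cont_on_face_mult: "cont_on_face e f \<Longrightarrow> cont_on_face e g \<Longrightarrow> cont_on_face e (\<lambda>x. f x * g x)"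
  unfolding cont_on_face_def by (elim exE conjE, rule_tac x="\<lambda>x. p x * pa x" in exI) (auto intro: continuous_intros)

lemma cont_on_faceI: "continuous_on UNIV p \<Longrightarrow> (\<And>x. x \<in> rel_interior e \<Longrightarrow> g x = p x) \<Longrightarrow> cont_on_face e g"
  unfolding cont_on_face_def by blast

text \<open>All four rules pass through the prism: a function on the face is replaced, up to the
  null set N, by its continuous extension composed with \<pi>, which is integrable over the compact
  K.\<close>

lemma
  assumes e: "flat_face e" "\<exists>\<nu>. normal_to e \<nu>" and f: "cont_on_face e f"
  shows face_integral_cong: "(\<And>x. x \<in> rel_interior e \<Longrightarrow> g x = f x) \<Longrightarrow> face_integral e g = face_integral e f"
    and face_integral_add: "cont_on_face e g \<Longrightarrow> face_integral e (\<lambda>x. f x + g x) = face_integral e f + face_integral e g"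
    and face_integral_scale: "face_integral e (\<lambda>x. c * f x) = c * face_integral e f"
    and face_integral_nonneg_eq_0: "(\<And>x. x \<in> rel_interior e \<Longrightarrow> 0 \<le> f x) \<Longrightarrow> face_integral e f = 0 \<Longrightarrow>
          y \<in> rel_interior e \<Longrightarrow> f y = 0"
proof -
  obtain K N and \<pi> :: "'a \<Rightarrow> 'a" where K: "compact K" "continuous_on UNIV \<pi>" "negligible N"
    "\<And>x. x \<in> K - N \<Longrightarrow> \<pi> x \<in> rel_interior e"
    "\<And>y. y \<in> rel_interior e \<Longrightarrow> \<exists>x\<in>interior K. \<pi> x = y"
    "\<And>g. face_integral e g = set_lebesgue_integral lebesgue K (\<lambda>x. g (\<pi> x))"
    using face_integral_prism[OF e] by metis
  have cont: "continuous_on S (\<lambda>x. p (\<pi> x))" if "continuous_on UNIV p" for p :: "'a \<Rightarrow> real" and S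
    using continuous_on_compose2[OF that K(2)] continuous_on_subset by blast
  have int: "(\<lambda>x. p (\<pi> x)) absolutely_integrable_on K" if "continuous_on UNIV p" for p :: "'a \<Rightarrow> real"
    using absolutely_integrable_continuous_compact[OF K(1) cont[OF that]] .
  have spike: "(\<lambda>x. g (\<pi> x)) absolutely_integrable_on K"
    "face_integral e g = set_lebesgue_integral lebesgue K (\<lambda>x. p (\<pi> x))"
    if "continuous_on UNIV p" "\<And>x. x \<in> rel_interior e \<Longrightarrow> g x = p x" for p g
    using set_lebesgue_integral_spike[OF int[OF that(1)] K(3), of "\<lambda>x. g (\<pi> x)"] that(2) K(4)
    by (auto simp: K(6))
  have intf: "(\<lambda>x. g (\<pi> x)) absolutely_integrable_on K" if "cont_on_face e g" for g
    using that spike(1) unfolding cont_on_face_def by blast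
  obtain p where p: "continuous_on UNIV p" "\<And>x. x \<in> rel_interior e \<Longrightarrow> f x = p x"
    using f unfolding cont_on_face_def by blast
  show "face_integral e g = face_integral e f" if "\<And>x. x \<in> rel_interior e \<Longrightarrow> g x = f x"
    using spike(2)[OF p] spike(2)[OF p(1), of g] that p(2) by simp
  show "face_integral e (\<lambda>x. f x + g x) = face_integral e f + face_integral e g" if "cont_on_face e g"
    using set_integral_add(2)[OF intf[OF f] intf[OF that]] by (simp add: K(6))
  show "face_integral e (\<lambda>x. c * f x) = c * face_integral e f"
    by (simp add: K(6) set_integral_mult_right)
  show "f y = 0" if nn: "\<And>x. x \<in> rel_interior e \<Longrightarrow> 0 \<le> f x" and 0: "face_integral e f = 0"
    and y: "y \<in> rel_interior e"
  proof -
    \<comment> \<open>The extension p may be negative off the face; its absolute value is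
      continuous, nonnegative everywhere and still agrees with f on the relative interior.\<close>
    have ca: "continuous_on UNIV (\<lambda>x. \<bar>p x\<bar>)" using p(1) by (intro continuous_intros)
    have "face_integral e f = set_lebesgue_integral lebesgue K (\<lambda>x. \<bar>p (\<pi> x)\<bar>)"
      using p nn by (intro spike(2)[OF ca]) auto
    moreover obtain x where x: "x \<in> interior K" "\<pi> x = y" using K(5)[OF y] by blast
    ultimately have "\<bar>p (\<pi> x)\<bar> = 0"
      using 0 set_lebesgue_integral_nonneg_eq_0[OF int[OF ca], of "interior K" x] interior_subset cont[OF ca]
      by auto
    then show ?thesis using x(2) p(2)[OF y] by simp
  qed
qed

section \<open>The weak gradient\<close>

text \<open>Element integrals depend on the values in the interior, as the frontier is null. A
  continuous extension to the whole space, rather than continuity on the interior, gives boundedness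
  on the compact element.\<close>

definition cont_on_elem :: "'a::euclidean_space set \<Rightarrow> ('a \<Rightarrow> 'b::euclidean_space) \<Rightarrow> bool" where
  "cont_on_elem T g \<longleftrightarrow> (\<exists>p. continuous_on UNIV p \<and> (\<forall>x\<in>interior T. g x = p x))"

lemma cont_on_elemI: "continuous_on UNIV p \<Longrightarrow> (\<And>x. x \<in> interior T \<Longrightarrow> g x = p x) \<Longrightarrow> cont_on_elem T g"
  unfolding cont_on_elem_def by blast

lemma cont_on_elem_continuous: "continuous_on UNIV g \<Longrightarrow> cont_on_elem T g"
  by (rule cont_on_elemI) auto

lemma cont_on_elem_inner: "cont_on_elem T f \<Longrightarrow> cont_on_elem T g \<Longrightarrow> cont_on_elem T (\<lambda>x. f x \<bullet> g x)"
  unfolding cont_on_elem_def by (elim exE conjE, rule_tac x="\<lambda>x. p x \<bullet> pa x" in exI) (auto intro: continuous_intros)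

lemma cont_on_elem_mult:
  fixes f g :: "'a::euclidean_space \<Rightarrow> real"
  shows "cont_on_elem T f \<Longrightarrow> cont_on_elem T g \<Longrightarrow> cont_on_elem T (\<lambda>x. f x * g x)"
  using cont_on_elem_inner[of T f g] by simp

section \<open>Meshes and integrals over their elements\<close>

locale polytopal_elements =
  fixes \<Omega> :: "'a::euclidean_space set" and Th :: "'a set set" and F :: "'a set \<Rightarrow> 'a set set"
  assumes mesh: "polytopal_mesh \<Omega> Th F"
begin

lemma finite_Th: "finite Th" and open_\<Omega>: "open \<Omega>" and bounded_\<Omega>: "bounded \<Omega>"
  and \<Omega>_eq: "\<Omega> = interior (\<Union>Th)"
proof -
  note m = mesh[unfolded polytopal_mesh_def]
  show "finite Th" using m by (elim conjE)
  show "open \<Omega>" using m by (elim conjE)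
  show "bounded \<Omega>" using m by (elim conjE)
  show "\<Omega> = interior (\<Union>Th)" using m by (elim conjE)
qed

lemma
  assumes "T \<in> Th"
  shows compact_elem: "compact T" and interior_elem_nonempty: "interior T \<noteq> {}"
    and connected_interior_elem: "connected (interior T)" and elem_eq_closure: "T = closure (interior T)"
    and finite_faces: "finite (F T)" and frontier_elem: "frontier T = \<Union>(F T)"
    and faces: "\<forall>e\<in>F T. flat_face e \<and> (\<exists>\<nu>. outward_normal T e \<nu>)"
proof -
  have "\<forall>T\<in>Th. compact T \<and> interior T \<noteq> {} \<and> connected (interior T) \<and>
        T = closure (interior T) \<and>
        finite (F T) \<and> F T \<noteq> {} \<and> frontier T = \<Union>(F T) \<and>
        (\<forall>e\<in>F T. flat_face e \<and> (\<exists>\<nu>. outward_normal T e \<nu>))"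
    using mesh unfolding polytopal_mesh_def by (elim conjE)
  note m = bspec[OF this assms]
  show "compact T" using m by (elim conjE)
  show "interior T \<noteq> {}" using m by (elim conjE)
  show "connected (interior T)" using m by (elim conjE)
  show "T = closure (interior T)" using m by (elim conjE)
  show "finite (F T)" using m by (elim conjE)
  show "frontier T = \<Union>(F T)" using m by (elim conjE)
  show "\<forall>e\<in>F T. flat_face e \<and> (\<exists>\<nu>. outward_normal T e \<nu>)" using m by (elim conjE)
qed

lemma flat_face: "T \<in> Th \<Longrightarrow> e \<in> F T \<Longrightarrow> flat_face e"
  and ex_outward_normal: "T \<in> Th \<Longrightarrow> e \<in> F T \<Longrightarrow> \<exists>\<nu>. outward_normal T e \<nu>"
  using faces by blast+

lemma ex_normal: "T \<in> Th \<Longrightarrow> e \<in> F T \<Longrightarrow> \<exists>\<nu>. normal_to e \<nu>"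
  using ex_outward_normal unfolding outward_normal_def by blast

lemma interiors_disjoint: "T \<in> Th \<Longrightarrow> T' \<in> Th \<Longrightarrow> x \<in> interior T \<Longrightarrow> x \<in> interior T' \<Longrightarrow> T = T'"
proof -
  have "\<forall>T\<in>Th. \<forall>T'\<in>Th. T \<noteq> T' \<longrightarrow> interior T \<inter> interior T' = {}"
    using mesh unfolding polytopal_mesh_def by (elim conjE)
  then show "T \<in> Th \<Longrightarrow> T' \<in> Th \<Longrightarrow> x \<in> interior T \<Longrightarrow> x \<in> interior T' \<Longrightarrow> T = T'" by blast
qed

lemma faces_disjoint:
  assumes "T \<in> Th" "T' \<in> Th" "e \<in> F T" "e' \<in> F T'" "x \<in> rel_interior e" "x \<in> rel_interior e'"
  shows "e = e'"
proof -
  have "\<forall>T\<in>Th. \<forall>T'\<in>Th. \<forall>e\<in>F T. \<forall>e'\<in>F T'. e = e' \<or> rel_interior e \<inter> rel_interior e' = {}"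
    using mesh unfolding polytopal_mesh_def by (elim conjE)
  then show ?thesis using assms by blast
qed

lemma face_boundary_or_shared:
  assumes "T \<in> Th" "e \<in> F T"
  shows "e \<subseteq> frontier \<Omega> \<or> (\<exists>T'\<in>Th. T' \<noteq> T \<and> e \<in> F T')"
proof -
  have "\<forall>T\<in>Th. \<forall>e\<in>F T. e \<subseteq> frontier \<Omega> \<or> (\<exists>T'\<in>Th. T' \<noteq> T \<and> e \<in> F T')"
    using mesh unfolding polytopal_mesh_def by (elim conjE)
  then show ?thesis using assms by blast
qed

lemma face_subset_elem: "T \<in> Th \<Longrightarrow> e \<in> F T \<Longrightarrow> e \<subseteq> T"
  using frontier_elem compact_imp_closed[OF compact_elem] frontier_subset_closed by blast

lemma negligible_frontier: "T \<in> Th \<Longrightarrow> negligible (frontier T)"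
  unfolding frontier_elem by (intro negligible_Union finite_faces) (use ex_normal negligible_normal_to in blast)+

lemma elem_minus_frontier: "T \<in> Th \<Longrightarrow> x \<in> T - frontier T \<Longrightarrow> x \<in> interior T"
  using closure_subset by (fastforce simp: frontier_def)

text \<open>Interiors of distinct elements are disjoint, so at most one summand is nonzero. As a
  sum, the glued function is readily seen to be measurable and to lie in a span.\<close>

definition pieces :: "('a set \<Rightarrow> 'a \<Rightarrow> 'b::comm_monoid_add) \<Rightarrow> 'a \<Rightarrow> 'b" where
  "pieces h x = (\<Sum>T\<in>Th. if x \<in> interior T then h T x else 0)"

lemma pieces_interior:
  assumes "T \<in> Th" "x \<in> interior T"
  shows "pieces h x = h T x"
proof -
  have "pieces h x = (\<Sum>T'\<in>Th. if T' = T then h T x else 0)"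
    unfolding pieces_def using interiors_disjoint assms by (intro sum.cong) auto
  then show ?thesis using assms(1) finite_Th by simp
qed

lemma pieces_outside: "x \<notin> \<Union>(interior ` Th) \<Longrightarrow> pieces h x = 0"
  unfolding pieces_def by (intro sum.neutral) auto

lemma elem_integral_cong:
  assumes "T \<in> Th" "cont_on_elem T f" "\<And>x. x \<in> interior T \<Longrightarrow> g x = f x"
  shows "set_lebesgue_integral lebesgue T g = set_lebesgue_integral lebesgue T f"
    and "f absolutely_integrable_on T" "g absolutely_integrable_on T"
proof -
  obtain p where p: "continuous_on UNIV p" "\<And>x. x \<in> interior T \<Longrightarrow> f x = p x"
    using assms(2) unfolding cont_on_elem_def by blast
  have "p absolutely_integrable_on T"
    using absolutely_integrable_continuous_compact[OF compact_elem[OF assms(1)]] p(1) continuous_on_subset by blast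
  note sp = set_lebesgue_integral_spike[OF this negligible_frontier[OF assms(1)]]
  have "f x = p x" "g x = p x" if "x \<in> T - frontier T" for x
    using elem_minus_frontier[OF assms(1) that] assms(3) p(2) by auto
  then show "set_lebesgue_integral lebesgue T g = set_lebesgue_integral lebesgue T f"
    "f absolutely_integrable_on T" "g absolutely_integrable_on T"
    using sp[of f] sp[of g] by auto
qed

lemmas elem_integrable = elem_integral_cong(2)[OF _ _ refl]

lemma elem_integral_add:
  "T \<in> Th \<Longrightarrow> cont_on_elem T f \<Longrightarrow> cont_on_elem T g \<Longrightarrow>
   set_lebesgue_integral lebesgue T (\<lambda>x. f x + g x) = set_lebesgue_integral lebesgue T f + set_lebesgue_integral lebesgue T g"
  by (intro set_integral_add elem_integrable)

lemma elem_integral_nonneg_eq_0: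
  fixes f :: "'a \<Rightarrow> real"
  assumes "T \<in> Th" "cont_on_elem T f" "\<And>x. x \<in> interior T \<Longrightarrow> 0 \<le> f x"
    "set_lebesgue_integral lebesgue T f = 0" "x \<in> interior T"
  shows "f x = 0"
proof -
  obtain p where p: "continuous_on UNIV p" "\<And>x. x \<in> interior T \<Longrightarrow> f x = p x"
    using assms(2) unfolding cont_on_elem_def by blast
  define g where "g x = \<bar>p x\<bar>" for x
  have g: "continuous_on UNIV g" unfolding g_def using p(1) by (intro continuous_intros)
  have fg: "f x = g x" if "x \<in> interior T" for x using p(2)[OF that] assms(3)[OF that] by (simp add: g_def)
  note gT = elem_integral_cong[OF assms(1) cont_on_elem_continuous[OF g] fg]
  have "g x = 0"
  proof (rule set_lebesgue_integral_nonneg_eq_0[OF gT(2)])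
    show "set_lebesgue_integral lebesgue T g = 0" using gT(1) assms(4) by simp
    show "continuous_on (interior T) g" using g continuous_on_subset by blast
  qed (use assms(5) interior_subset in \<open>auto simp: g_def\<close>)
  then show ?thesis using fg[OF assms(5)] by simp
qed

text \<open>The right-hand side of the equation that defines the weak gradient, as a functional of
  the test field: integration by parts with independent interior and boundary data.\<close>

definition load :: "'a set \<Rightarrow> 'a wfun \<Rightarrow> ('a \<Rightarrow> 'a) \<Rightarrow> real" where
  "load T v \<tau> = - set_lebesgue_integral lebesgue T (\<lambda>x. fst v x * divg \<tau> x)
             + (\<Sum>e\<in>F T. face_integral e (\<lambda>x. snd v x * (\<tau> x \<bullet> onormal T e)))"

section \<open>Weak functions as a vector space and linearity of the load\<close>

lemma
  assumes "v \<in> Vh Th F k" "T \<in> Th"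
  shows Vh_elem: "\<exists>p\<in>Poly k. \<forall>x\<in>interior T. fst v x = p x"
    and Vh_face: "e \<in> F T \<Longrightarrow> \<exists>p\<in>Poly k. \<forall>x\<in>rel_interior e. snd v x = p x"
  using assms unfolding Vh_def by blast+

lemma Vh_cont_elem: "v \<in> Vh Th F k \<Longrightarrow> T \<in> Th \<Longrightarrow> cont_on_elem T (fst v)"
  using Vh_elem[of v k T] Poly_C1 C1_continuous cont_on_elemI by metis

lemma Vh_cont_face: "v \<in> Vh Th F k \<Longrightarrow> T \<in> Th \<Longrightarrow> e \<in> F T \<Longrightarrow> cont_on_face e (snd v)"
  using Vh_face[of v k T e] Poly_C1 C1_continuous cont_on_faceI by metis

lemma subspace_Vh: "subspace (Vh Th F k)"
proof (rule subspaceI)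
  show "0 \<in> Vh Th F k"
    using subspace_0[OF subspace_Poly] unfolding Vh_def
    by (auto intro!: bexI[of _ 0])
next
  fix u v and c :: real assume u: "u \<in> Vh Th F k"
  show "c *\<^sub>R u \<in> Vh Th F k"
    unfolding Vh_def
  proof (intro CollectI conjI ballI allI impI)
    fix T assume T: "T \<in> Th"
    from Vh_elem[OF u T] obtain p where "p \<in> Poly k" "\<forall>x\<in>interior T. fst u x = p x" by blast
    then show "\<exists>p\<in>Poly k. \<forall>x\<in>interior T. fst (c *\<^sub>R u) x = p x"
      by (intro bexI[of _ "c *\<^sub>R p"]) (auto intro: subspace_scale[OF subspace_Poly])
    fix e assume "e \<in> F T"
    from Vh_face[OF u T this] obtain p where "p \<in> Poly k" "\<forall>x\<in>rel_interior e. snd u x = p x" by blast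
    then show "\<exists>p\<in>Poly k. \<forall>x\<in>rel_interior e. snd (c *\<^sub>R u) x = p x"
      by (intro bexI[of _ "c *\<^sub>R p"]) (auto intro: subspace_scale[OF subspace_Poly])
  qed (use u in \<open>simp_all add: Vh_def\<close>)
  assume v: "v \<in> Vh Th F k"
  show "u + v \<in> Vh Th F k"
    unfolding Vh_def
  proof (intro CollectI conjI ballI allI impI)
    fix T assume T: "T \<in> Th"
    from Vh_elem[OF u T] Vh_elem[OF v T] obtain p q where "p \<in> Poly k" "\<forall>x\<in>interior T. fst u x = p x"
      "q \<in> Poly k" "\<forall>x\<in>interior T. fst v x = q x" by blast
    then show "\<exists>p\<in>Poly k. \<forall>x\<in>interior T. fst (u + v) x = p x"
      by (intro bexI[of _ "p + q"]) (auto intro: subspace_add[OF subspace_Poly])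
    fix e assume "e \<in> F T"
    from Vh_face[OF u T this] Vh_face[OF v T this] obtain p q where "p \<in> Poly k" "\<forall>x\<in>rel_interior e. snd u x = p x"
      "q \<in> Poly k" "\<forall>x\<in>rel_interior e. snd v x = q x" by blast
    then show "\<exists>p\<in>Poly k. \<forall>x\<in>rel_interior e. snd (u + v) x = p x"
      by (intro bexI[of _ "p + q"]) (auto intro: subspace_add[OF subspace_Poly])
  qed (use u v in \<open>simp_all add: Vh_def\<close>)
qed

lemma subspace_Vh0: "subspace (Vh0 \<Omega> Th F k)"
  using subspace_Vh[of k] unfolding subspace_def Vh0_def by auto

lemma face_term_cont:
  assumes "v \<in> Vh Th F k" "\<tau> \<in> VPoly j" "T \<in> Th" "e \<in> F T"
  shows "cont_on_face e (\<lambda>x. snd v x * (\<tau> x \<bullet> n))"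
proof -
  have "continuous_on UNIV \<tau>" using C1_continuous[OF VPoly_C1[OF assms(2)]] .
  then have "cont_on_face e (\<lambda>x. \<tau> x \<bullet> n)" by (intro cont_on_faceI) (auto intro!: continuous_intros)
  then show ?thesis using cont_on_face_mult Vh_cont_face[OF assms(1,3,4)] by blast
qed

lemma elem_term_cont:
  assumes "v \<in> Vh Th F k" "\<tau> \<in> VPoly j" "T \<in> Th"
  shows "cont_on_elem T (\<lambda>x. fst v x * divg \<tau> x)"
  using cont_on_elem_mult[OF Vh_cont_elem[OF assms(1,3)]
      cont_on_elem_continuous[OF C1_continuous_divg[OF VPoly_C1[OF assms(2)]]]] .

lemma load_add_left:
  assumes "u \<in> Vh Th F k" "v \<in> Vh Th F k" "\<tau> \<in> VPoly j" "T \<in> Th"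
  shows "load T (u + v) \<tau> = load T u \<tau> + load T v \<tau>"
proof -
  have "face_integral e (\<lambda>x. snd (u + v) x * (\<tau> x \<bullet> n)) =
      face_integral e (\<lambda>x. snd u x * (\<tau> x \<bullet> n)) + face_integral e (\<lambda>x. snd v x * (\<tau> x \<bullet> n))" if "e \<in> F T" for e n
    using face_integral_add[OF flat_face ex_normal face_term_cont[OF assms(1,3)] face_term_cont[OF assms(2,3)]]
      assms(4) that by (simp add: distrib_right)
  moreover have "set_lebesgue_integral lebesgue T (\<lambda>x. fst (u + v) x * divg \<tau> x) =
     set_lebesgue_integral lebesgue T (\<lambda>x. fst u x * divg \<tau> x) + set_lebesgue_integral lebesgue T (\<lambda>x. fst v x * divg \<tau> x)"
    using elem_integral_add[OF assms(4) elem_term_cont[OF assms(1,3,4)] elem_term_cont[OF assms(2,3,4)]]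
    by (simp add: distrib_right)
  ultimately show ?thesis by (simp add: load_def sum.distrib)
qed

lemma load_scale_left:
  assumes "u \<in> Vh Th F k" "\<tau> \<in> VPoly j" "T \<in> Th"
  shows "load T (c *\<^sub>R u) \<tau> = c * load T u \<tau>"
proof -
  have "face_integral e (\<lambda>x. snd (c *\<^sub>R u) x * (\<tau> x \<bullet> n)) = c * face_integral e (\<lambda>x. snd u x * (\<tau> x \<bullet> n))" if "e \<in> F T" for e n
    using face_integral_scale[OF flat_face[OF assms(3) that] ex_normal[OF assms(3) that]
        face_term_cont[OF assms(1-3) that], where c=c] by (simp add: mult.assoc)
  then show ?thesis
    by (simp add: load_def mult.assoc set_integral_mult_right sum_distrib_left right_diff_distrib)
qed

lemma linear_load:
  assumes v: "v \<in> Vh Th F k" and T: "T \<in> Th"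
  shows "linear_on_set (VPoly j) (load T v)"
proof (rule linear_on_setI)
  fix \<sigma> \<tau> :: "'a \<Rightarrow> 'a" and c :: real assume s: "\<sigma> \<in> VPoly j"
  have "face_integral e (\<lambda>x. snd v x * ((c *\<^sub>R \<sigma>) x \<bullet> n)) = c * face_integral e (\<lambda>x. snd v x * (\<sigma> x \<bullet> n))" if "e \<in> F T" for e n
    using face_integral_scale[OF flat_face[OF T that] ex_normal[OF T that] face_term_cont[OF v s T that], where c=c]
    by (simp add: mult.left_commute)
  then have fc: "(\<Sum>e\<in>F T. face_integral e (\<lambda>x. snd v x * ((c *\<^sub>R \<sigma>) x \<bullet> onormal T e))) =
      c * (\<Sum>e\<in>F T. face_integral e (\<lambda>x. snd v x * (\<sigma> x \<bullet> onormal T e)))"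
    unfolding sum_distrib_left by (intro sum.cong refl)
  have "(\<lambda>x. fst v x * divg (c *\<^sub>R \<sigma>) x) = (\<lambda>x. c * (fst v x * divg \<sigma> x))"
    by (simp add: fun_eq_iff divg_scale[OF VPoly_C1[OF s]] mult.left_commute)
  then show "load T v (c *\<^sub>R \<sigma>) = c * load T v \<sigma>"
    unfolding load_def fc by (simp add: set_integral_mult_right right_diff_distrib)
  assume t: "\<tau> \<in> VPoly j"
  have "face_integral e (\<lambda>x. snd v x * ((\<sigma> + \<tau>) x \<bullet> n)) =
      face_integral e (\<lambda>x. snd v x * (\<sigma> x \<bullet> n)) + face_integral e (\<lambda>x. snd v x * (\<tau> x \<bullet> n))" if "e \<in> F T" for e n
    using face_integral_add[OF flat_face ex_normal face_term_cont[OF v s] face_term_cont[OF v t]]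
      T that by (simp add: inner_add_left distrib_left)
  moreover have "set_lebesgue_integral lebesgue T (\<lambda>x. fst v x * divg (\<sigma> + \<tau>) x) =
     set_lebesgue_integral lebesgue T (\<lambda>x. fst v x * divg \<sigma> x) + set_lebesgue_integral lebesgue T (\<lambda>x. fst v x * divg \<tau> x)"
    using elem_integral_add[OF T elem_term_cont[OF v s T] elem_term_cont[OF v t T]]
      divg_add[OF VPoly_C1[OF s] VPoly_C1[OF t]] by (simp add: distrib_left)
  ultimately show "load T v (\<sigma> + \<tau>) = load T v \<sigma> + load T v \<tau>" by (simp add: load_def sum.distrib)
qed

section \<open>Existence, uniqueness and linearity of the weak gradient\<close>

definition elem_ip :: "'a set \<Rightarrow> ('a \<Rightarrow> 'a) \<Rightarrow> ('a \<Rightarrow> 'a) \<Rightarrow> real" where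
  "elem_ip T \<sigma> \<tau> = set_lebesgue_integral lebesgue T (\<lambda>x. \<sigma> x \<bullet> \<tau> x)"

lemma elem_ip_commute: "elem_ip T \<sigma> \<tau> = elem_ip T \<tau> \<sigma>"
  by (simp add: elem_ip_def inner_commute)

lemma elem_ip_add: "T \<in> Th \<Longrightarrow> cont_on_elem T \<rho> \<Longrightarrow> cont_on_elem T \<sigma> \<Longrightarrow> cont_on_elem T \<tau> \<Longrightarrow>
    elem_ip T (\<rho> + \<sigma>) \<tau> = elem_ip T \<rho> \<tau> + elem_ip T \<sigma> \<tau>"
  unfolding elem_ip_def by (simp add: inner_add_left elem_integral_add cont_on_elem_inner)

lemma elem_ip_scale: "elem_ip T (c *\<^sub>R \<sigma>) \<tau> = c * elem_ip T \<sigma> \<tau>"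
  by (simp add: elem_ip_def set_integral_mult_right)

lemma elem_ip_nonneg: "0 \<le> elem_ip T \<sigma> \<sigma>"
  unfolding elem_ip_def set_lebesgue_integral_def by (intro Bochner_Integration.integral_nonneg) auto

lemma elem_ip_eq_0:
  "T \<in> Th \<Longrightarrow> cont_on_elem T \<sigma> \<Longrightarrow> elem_ip T \<sigma> \<sigma> = 0 \<Longrightarrow> x \<in> interior T \<Longrightarrow> \<sigma> x = 0"
  using elem_integral_nonneg_eq_0[of T "\<lambda>x. \<sigma> x \<bullet> \<sigma> x" x] by (simp add: elem_ip_def cont_on_elem_inner)

lemma VPoly_cont_elem: "\<tau> \<in> VPoly j \<Longrightarrow> cont_on_elem T \<tau>"
  using cont_on_elem_continuous C1_continuous VPoly_C1 by blast

lemma semi_inner_VPoly: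
  assumes "T \<in> Th"
  shows "semi_inner (VPoly j) (elem_ip T)"
proof
  show "subspace (VPoly j :: ('a \<Rightarrow> 'a) set)" by (rule subspace_VPoly)
qed (use assms in \<open>auto intro!: linear_on_setI elem_ip_commute elem_ip_add elem_ip_scale elem_ip_nonneg VPoly_cont_elem\<close>)

text \<open>This is the kernel condition of \<open>riesz_span\<close>. Such a \<tau> vanishes on the
  interior, by continuity on its closure T and so on all faces; its divergence vanishes on the
  interior because that set is open.\<close>

lemma load_kernel:
  assumes v: "v \<in> Vh Th F k" and T: "T \<in> Th" and \<tau>: "\<tau> \<in> VPoly j" and 0: "elem_ip T \<tau> \<tau> = 0"
  shows "load T v \<tau> = 0"
proof -
  have int0: "\<tau> x = 0" if "x \<in> interior T" for x
    using elem_ip_eq_0[OF T VPoly_cont_elem[OF \<tau>] 0 that] .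
  have T0: "\<tau> x = 0" if "x \<in> T" for x
  proof (rule continuous_constant_on_closure[of "interior T" \<tau> 0])
    show "continuous_on (closure (interior T)) \<tau>" using C1_continuous[OF VPoly_C1[OF \<tau>]] .
    show "x \<in> closure (interior T)" using that elem_eq_closure[OF T] by (rule back_subst)
  qed (use int0 in auto)
  have "set_lebesgue_integral lebesgue T (\<lambda>x. fst v x * divg \<tau> x) = set_lebesgue_integral lebesgue T (\<lambda>x. 0)"
    using divg_eq_0_open[OF open_interior _ int0]
    by (intro elem_integral_cong[OF T]) (auto intro: cont_on_elem_continuous)
  then have "set_lebesgue_integral lebesgue T (\<lambda>x. fst v x * divg \<tau> x) = 0" by simp
  moreover have "face_integral e (\<lambda>x. snd v x * (\<tau> x \<bullet> n)) = 0" if e: "e \<in> F T" for e n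
  proof -
    have "face_integral e (\<lambda>x. snd v x * (\<tau> x \<bullet> n)) = face_integral e (\<lambda>x. 0)"
      using T0 face_subset_elem[OF T e] rel_interior_subset[of e]
      by (intro face_integral_cong[OF flat_face[OF T e] ex_normal[OF T e]]) (auto intro: cont_on_faceI[of "\<lambda>x. 0"])
    then show ?thesis
      by (simp add: face_integral_def Let_def set_lebesgue_integral_def)
  qed
  ultimately show ?thesis by (simp add: load_def)
qed

text \<open>The predicate under the definite description. Vanishing off the interiors singles out
  one representative, which makes uniqueness an equality of functions.\<close>

definition is_wgrad :: "nat \<Rightarrow> 'a wfun \<Rightarrow> ('a \<Rightarrow> 'a) \<Rightarrow> bool" where
  "is_wgrad k v W \<longleftrightarrow> (\<forall>x. x \<notin> \<Union>(interior ` Th) \<longrightarrow> W x = 0) \<and>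
     (\<forall>T\<in>Th. (\<exists>q\<in>VPoly (jdeg F k T). \<forall>x\<in>interior T. W x = q x) \<and>
        (\<forall>\<tau>\<in>VPoly (jdeg F k T). elem_ip T W \<tau> = load T v \<tau>))"

lemma wgrad_eq_The: "wgrad Th F k v = (THE W. is_wgrad k v W)"
  unfolding wgrad_def is_wgrad_def elem_ip_def load_def ..

lemma is_wgrad_cont: "is_wgrad k v W \<Longrightarrow> T \<in> Th \<Longrightarrow> cont_on_elem T W"
  unfolding is_wgrad_def using VPoly_C1 C1_continuous cont_on_elemI by metis

lemma is_wgrad_exists:
  assumes v: "v \<in> Vh Th F k"
  shows "\<exists>W. is_wgrad k v W"
proof -
  have "\<exists>w\<in>VPoly (jdeg F k T). \<forall>\<tau>\<in>VPoly (jdeg F k T). elem_ip T w \<tau> = load T v \<tau>" if T: "T \<in> Th" for T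
  proof -
    interpret semi_inner "VPoly (jdeg F k T)" "elem_ip T" using semi_inner_VPoly[OF T] .
    obtain B :: "('a \<Rightarrow> 'a) set" where B: "finite B" "span B = VPoly (jdeg F k T)"
      using VPoly_finite_dim subspace_finite_span[OF subspace_VPoly] by metis
    show ?thesis
      using riesz_span[OF B(1), of "load T v"] B(2) linear_load[OF v T] load_kernel[OF v T] by simp
  qed
  then obtain w where w: "\<And>T. T \<in> Th \<Longrightarrow> w T \<in> VPoly (jdeg F k T)"
    "\<And>T \<tau>. T \<in> Th \<Longrightarrow> \<tau> \<in> VPoly (jdeg F k T) \<Longrightarrow> elem_ip T (w T) \<tau> = load T v \<tau>" by metis
  have "elem_ip T (pieces w) \<tau> = elem_ip T (w T) \<tau>" if "T \<in> Th" "\<tau> \<in> VPoly (jdeg F k T)" for T \<tau>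
    unfolding elem_ip_def using that w(1)
    by (intro elem_integral_cong cont_on_elem_inner VPoly_cont_elem) (auto simp: pieces_interior)
  then have "is_wgrad k v (pieces w)"
    unfolding is_wgrad_def using w pieces_interior pieces_outside by (auto intro!: bexI[of _ "w _"])
  then show ?thesis by blast
qed

lemma is_wgrad_add:
  assumes "u \<in> Vh Th F k" "v \<in> Vh Th F k" and W: "is_wgrad k u W" "is_wgrad k v W'"
  shows "is_wgrad k (u + v) (W + W')"
  unfolding is_wgrad_def
proof (intro conjI ballI allI impI)
  fix T assume T: "T \<in> Th"
  from W T obtain p q where "p \<in> VPoly (jdeg F k T)" "\<forall>x\<in>interior T. W x = p x"
    "q \<in> VPoly (jdeg F k T)" "\<forall>x\<in>interior T. W' x = q x" unfolding is_wgrad_def by metis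
  then show "\<exists>q\<in>VPoly (jdeg F k T). \<forall>x\<in>interior T. (W + W') x = q x"
    by (intro bexI[of _ "p + q"]) (auto intro: subspace_add[OF subspace_VPoly])
  fix \<tau> :: "'a \<Rightarrow> 'a" assume \<tau>: "\<tau> \<in> VPoly (jdeg F k T)"
  have "elem_ip T W \<tau> = load T u \<tau>" "elem_ip T W' \<tau> = load T v \<tau>"
    using W T \<tau> unfolding is_wgrad_def by blast+
  then show "elem_ip T (W + W') \<tau> = load T (u + v) \<tau>"
    using elem_ip_add[OF T is_wgrad_cont[OF W(1) T] is_wgrad_cont[OF W(2) T] VPoly_cont_elem[OF \<tau>]]
      load_add_left[OF assms(1,2) \<tau> T] by simp
qed (use W in \<open>simp add: is_wgrad_def\<close>)

lemma is_wgrad_scale: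
  assumes "v \<in> Vh Th F k" and W: "is_wgrad k v W"
  shows "is_wgrad k (c *\<^sub>R v) (c *\<^sub>R W)"
  unfolding is_wgrad_def
proof (intro conjI ballI allI impI)
  fix T assume T: "T \<in> Th"
  from W T obtain p where "p \<in> VPoly (jdeg F k T)" "\<forall>x\<in>interior T. W x = p x" unfolding is_wgrad_def by metis
  then show "\<exists>q\<in>VPoly (jdeg F k T). \<forall>x\<in>interior T. (c *\<^sub>R W) x = q x"
    by (intro bexI[of _ "c *\<^sub>R p"]) (auto intro: subspace_scale[OF subspace_VPoly])
  fix \<tau> :: "'a \<Rightarrow> 'a" assume \<tau>: "\<tau> \<in> VPoly (jdeg F k T)"
  have "elem_ip T W \<tau> = load T v \<tau>" using W T \<tau> unfolding is_wgrad_def by blast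
  then show "elem_ip T (c *\<^sub>R W) \<tau> = load T (c *\<^sub>R v) \<tau>"
    using load_scale_left[OF assms(1) \<tau> T] by (simp add: elem_ip_scale)
qed (use W in \<open>simp add: is_wgrad_def\<close>)

text \<open>The difference D is a weak gradient of v - v, whose load is 0. On each element D agrees
  with an admissible test field q, and testing with q shows that D has norm 0.\<close>

lemma is_wgrad_unique:
  assumes v: "v \<in> Vh Th F k" and W: "is_wgrad k v W" and W': "is_wgrad k v W'"
  shows "W = W'"
proof
  define D where "D = W + (-1) *\<^sub>R W'"
  have D: "is_wgrad k (v + (-1) *\<^sub>R v) D"
    unfolding D_def using v W W' by (intro is_wgrad_add is_wgrad_scale subspace_scale[OF subspace_Vh])
  have "D x = 0" for x
  proof (cases "x \<in> \<Union>(interior ` Th)")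
    case True
    then obtain T where T: "T \<in> Th" "x \<in> interior T" by blast
    obtain q where q: "q \<in> VPoly (jdeg F k T)" "\<And>x. x \<in> interior T \<Longrightarrow> D x = q x"
      using D T(1) unfolding is_wgrad_def by metis
    have "elem_ip T D D = elem_ip T D q"
      unfolding elem_ip_def using q is_wgrad_cont[OF D T(1)] VPoly_cont_elem
      by (intro elem_integral_cong[OF T(1)] cont_on_elem_inner) auto
    also have "\<dots> = load T (v + (-1) *\<^sub>R v) q" using D T(1) q(1) unfolding is_wgrad_def by blast
    also have "\<dots> = 0"
      using load_scale_left[OF v q(1) T(1), of 0] by simp
    finally show ?thesis using elem_ip_eq_0[OF T(1) is_wgrad_cont[OF D T(1)]] T(2) by blast
  next
    case False
    then show ?thesis using D unfolding is_wgrad_def by blast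
  qed
  then show "W x = W' x" for x by (simp add: D_def fun_eq_iff)
qed

lemma is_wgrad_wgrad: "v \<in> Vh Th F k \<Longrightarrow> is_wgrad k v (wgrad Th F k v)"
  unfolding wgrad_eq_The using is_wgrad_exists is_wgrad_unique by (metis theI)

lemma wgrad_add:
  "u \<in> Vh Th F k \<Longrightarrow> v \<in> Vh Th F k \<Longrightarrow> wgrad Th F k (u + v) = wgrad Th F k u + wgrad Th F k v"
  using is_wgrad_unique is_wgrad_add is_wgrad_wgrad subspace_add[OF subspace_Vh] by metis

lemma wgrad_scale: "v \<in> Vh Th F k \<Longrightarrow> wgrad Th F k (c *\<^sub>R v) = c *\<^sub>R wgrad Th F k v"
  using is_wgrad_unique is_wgrad_scale is_wgrad_wgrad subspace_scale[OF subspace_Vh] by metis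

lemma wgrad_diff:
  assumes "u \<in> Vh Th F k" "v \<in> Vh Th F k"
  shows "wgrad Th F k (u - v) = wgrad Th F k u - wgrad Th F k v"
  using wgrad_add[OF assms(1) subspace_scale[OF subspace_Vh assms(2)], of "-1"] wgrad_scale[OF assms(2), of "-1"]
  by simp

lemma wgrad_cont: "v \<in> Vh Th F k \<Longrightarrow> T \<in> Th \<Longrightarrow> cont_on_elem T (wgrad Th F k v)"
  using is_wgrad_cont is_wgrad_wgrad by blast

section \<open>The energy inner product\<close>

definition energy :: "nat \<Rightarrow> 'a wfun \<Rightarrow> 'a wfun \<Rightarrow> real" where
  "energy k u v = (\<Sum>T\<in>Th. elem_ip T (wgrad Th F k u) (wgrad Th F k v))"

lemma Vh0_subset: "Vh0 \<Omega> Th F k \<subseteq> Vh Th F k"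
  by (auto simp: Vh0_def)

lemma semi_inner_energy: "semi_inner (Vh0 \<Omega> Th F k) (energy k)"
proof
  show "subspace (Vh0 \<Omega> Th F k)" by (rule subspace_Vh0)
  show "energy k u v = energy k v u" for u v by (simp add: energy_def elem_ip_commute)
  show "0 \<le> energy k v v" for v by (simp add: energy_def sum_nonneg elem_ip_nonneg)
  fix v assume "v \<in> Vh0 \<Omega> Th F k"
  then have v: "v \<in> Vh Th F k" using Vh0_subset by blast
  show "linear_on_set (Vh0 \<Omega> Th F k) (\<lambda>u. energy k u v)"
  proof (rule linear_on_set_mono[OF linear_on_setI Vh0_subset])
    fix u w assume uw: "u \<in> Vh Th F k" "w \<in> Vh Th F k"
    show "energy k (u + w) v = energy k u v + energy k w v"
      unfolding energy_def wgrad_add[OF uw] sum.distrib[symmetric]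
      using uw v by (intro sum.cong refl elem_ip_add wgrad_cont)
    show "energy k (c *\<^sub>R u) v = c * energy k u v" for c
      unfolding energy_def wgrad_scale[OF uw(1)] elem_ip_scale sum_distrib_left ..
  qed
qed

lemma tnorm_eq_0_iff: "tnorm Th F k v = 0 \<longleftrightarrow> energy k v v = 0"
  by (simp add: tnorm_def energy_def elem_ip_def)

end

section \<open>Definiteness of the energy\<close>

lemma set_lebesgue_integral_mono_negligible:
  fixes f g :: "'a::euclidean_space \<Rightarrow> real"
  assumes "f absolutely_integrable_on S" "g absolutely_integrable_on S" "negligible N"
    and "\<And>x. x \<in> S - N \<Longrightarrow> f x \<le> g x"
  shows "set_lebesgue_integral lebesgue S f \<le> set_lebesgue_integral lebesgue S g"
proof (rule set_integral_mono_AE[OF assms(1,2)])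
  have "AE x in lebesgue. x \<notin> N"
    using assms(3) by (simp add: negligible_iff_null_sets AE_not_in)
  then show "AE x\<in>S in lebesgue. f x \<le> g x"
    by eventually_elim (use assms(4) in auto)
qed

lemma face_integral_nonneg: "(\<And>x. 0 \<le> g x) \<Longrightarrow> 0 \<le> face_integral e g"
  unfolding face_integral_def Let_def set_lebesgue_integral_def
  by (intro Bochner_Integration.integral_nonneg) auto

text \<open>Serves to cancel the weight \<open>inverse (diameter T)\<close> in
  \<open>norm1h\<close>; as \<open>inverse 0 = 0\<close>, a zero diameter would hide the face
  terms.\<close>

lemma diameter_pos:
  assumes "bounded T" "interior T \<noteq> {}"
  shows "0 < diameter (T :: 'a::euclidean_space set)"
proof -
  obtain x r where r: "r > 0" "cball x r \<subseteq> T"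
    using assms(2) by (metis ex_in_conv mem_interior_cball)
  obtain b :: 'a where b: "b \<in> Basis" using nonempty_Basis by blast
  have "x \<in> T" "x + r *\<^sub>R b \<in> T" using r b by (auto simp: subset_iff dist_norm)
  then have "dist x (x + r *\<^sub>R b) \<le> diameter T"
    using diameter_bounded_bound[OF assms(1)] by blast
  then show ?thesis using r(1) b by (simp add: dist_norm)
qed

context polytopal_elements
begin

text \<open>Since T is the closure of its interior, a frontier point is a limit point of the
  interior, so the limit that defines the trace is unique.\<close>

lemma trace_from_constant:
  assumes "T \<in> Th" "x \<in> frontier T" "\<And>y. y \<in> interior T \<Longrightarrow> g y = c"
  shows "trace_from T g x = c"
  unfolding trace_from_def
proof (rule tendsto_Lim)
  have "x \<in> T" using assms(1,2) compact_imp_closed[OF compact_elem] frontier_subset_closed by blast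
  then have "x \<in> closure (interior T)" using elem_eq_closure[OF assms(1)] by (rule back_subst)
  moreover have "x \<notin> interior T" using assms(2) by (simp add: frontier_def)
  ultimately show "at x within interior T \<noteq> bot" by (simp add: closure_def trivial_limit_within)
  show "(g \<longlongrightarrow> c) (at x within interior T)"
    by (rule tendsto_eventually) (simp add: eventually_at_filter assms(3))
qed

text \<open>All summands are nonnegative, hence zero. A vanishing gradient on the connected interior
  gives a constant c, its trace on every face is c, and the vanishing jump identifies
  \<open>snd v\<close> with c there.\<close>

lemma norm1h_eq_0_imp_constant:
  assumes v: "v \<in> Vh Th F k" and "norm1h Th F v \<le> 0" and T: "T \<in> Th"
  obtains c where "\<And>x. x \<in> interior T \<Longrightarrow> fst v x = c"
    "\<And>e x. e \<in> F T \<Longrightarrow> x \<in> rel_interior e \<Longrightarrow> snd v x = c"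
proof -
  define A where "A T = set_lebesgue_integral lebesgue T (\<lambda>x. (norm (grad (fst v) x))\<^sup>2)" for T
  define B where "B T e = face_integral e (\<lambda>x. (trace_from T (fst v) x - snd v x)\<^sup>2)" for T e
  have A0: "0 \<le> A T" for T
    unfolding A_def set_lebesgue_integral_def by (intro Bochner_Integration.integral_nonneg) auto
  have B0: "0 \<le> B T e" for T e
    unfolding B_def by (intro face_integral_nonneg) auto
  have dia: "0 < diameter T" if "T \<in> Th" for T
    using diameter_pos[OF compact_imp_bounded[OF compact_elem[OF that]] interior_elem_nonempty[OF that]] .
  have nn: "0 \<le> A T + inverse (diameter T) * (\<Sum>e\<in>F T. B T e)" if "T \<in> Th" for T
    using A0[of T] B0[of T] dia[OF that] by (intro add_nonneg_nonneg mult_nonneg_nonneg sum_nonneg) auto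
  have "(\<Sum>T\<in>Th. A T + inverse (diameter T) * (\<Sum>e\<in>F T. B T e)) \<le> 0"
    using assms(2) by (simp add: norm1h_def A_def B_def)
  then have S0: "(\<Sum>T\<in>Th. A T + inverse (diameter T) * (\<Sum>e\<in>F T. B T e)) = 0"
    by (rule order.antisym) (intro sum_nonneg nn)
  have "A T + inverse (diameter T) * (\<Sum>e\<in>F T. B T e) = 0"
    by (rule sum_nonneg_0[OF finite_Th _ S0 T]) (rule nn)
  moreover have "0 \<le> inverse (diameter T) * (\<Sum>e\<in>F T. B T e)"
    using B0[of T] dia[OF T] by (intro mult_nonneg_nonneg sum_nonneg) auto
  ultimately have AT: "A T = 0" and "inverse (diameter T) * (\<Sum>e\<in>F T. B T e) = 0"
    using A0[of T] by linarith+
  then have B0T: "(\<Sum>e\<in>F T. B T e) = 0" using dia[OF T] by simp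
  have BT: "B T e = 0" if "e \<in> F T" for e
    by (rule sum_nonneg_0[OF finite_faces[OF T] _ B0T that]) (rule B0)
  obtain p where p: "p \<in> Poly k" "\<And>x. x \<in> interior T \<Longrightarrow> fst v x = p x"
    using Vh_elem[OF v T] by blast
  have C1p: "C1 p" using Poly_C1[OF p(1)] .
  have gr: "grad (fst v) x = grad p x" if "x \<in> interior T" for x
    using grad_cong_open[OF C1p open_interior that p(2)] .
  have "grad p x = 0" if x: "x \<in> interior T" for x
  proof -
    have "cont_on_elem T (\<lambda>x. (norm (grad (fst v) x))\<^sup>2)"
      using C1_continuous_grad[OF C1p] gr
      by (intro cont_on_elemI[of "\<lambda>x. (norm (grad p x))\<^sup>2"]) (auto intro!: continuous_intros)
    from elem_integral_nonneg_eq_0[OF T this _ _ x] show ?thesis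
      using AT gr[OF x] by (simp add: A_def)
  qed
  then obtain c where "\<And>x. x \<in> interior T \<Longrightarrow> p x = c"
    using grad_0_imp_constant[OF C1p open_interior connected_interior_elem[OF T]] by blast
  then have c: "fst v x = c" if "x \<in> interior T" for x using p(2) that by simp
  have "snd v x = c" if e: "e \<in> F T" and x: "x \<in> rel_interior e" for e x
  proof -
    have cf: "cont_on_face e (\<lambda>x. (c - snd v x)\<^sup>2)"
    proof -
      obtain q where "continuous_on UNIV q" "\<And>x. x \<in> rel_interior e \<Longrightarrow> snd v x = q x"
        using Vh_cont_face[OF v T e] unfolding cont_on_face_def by blast
      then show ?thesis by (intro cont_on_faceI[of "\<lambda>x. (c - q x)\<^sup>2"]) (auto intro!: continuous_intros)
    qed
    have "trace_from T (fst v) y = c" if "y \<in> rel_interior e" for y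
    proof (rule trace_from_constant[OF T])
      show "y \<in> frontier T"
        unfolding frontier_elem[OF T] using e that rel_interior_subset[of e] by blast
    qed (rule c)
    then have "face_integral e (\<lambda>x. (c - snd v x)\<^sup>2) = B T e"
      unfolding B_def
      by (intro face_integral_cong[OF flat_face[OF T e] ex_normal[OF T e] cf, symmetric]) simp
    then have "(c - snd v x)\<^sup>2 = 0"
      using face_integral_nonneg_eq_0[OF flat_face[OF T e] ex_normal[OF T e] cf _ _ x] BT[OF e] by simp
    then show ?thesis by simp
  qed
  then show thesis using that c by blast
qed

text \<open>The part of the mesh of codimension two, where adjacency across a face gives no
  information.\<close>

definition skeleton :: "'a set" where
  "skeleton = (\<Union>T\<in>Th. \<Union>e\<in>F T. e - rel_interior e)"

text \<open>Near a point of a shared face off the skeleton, the hyperplane of the face cuts a small ball into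
  two connected halves, and neither of them meets the frontier of an adjacent element.\<close>

lemma shared_face_interior:
  assumes T: "T \<in> Th" "e \<in> F T" and T': "T' \<in> Th" "e \<in> F T'" and "T \<noteq> T'"
    and x: "x \<in> rel_interior e" "x \<notin> skeleton"
  shows "x \<in> interior (T \<union> T')"
proof -
  define C where "C = \<Union>((F T \<union> F T') - {e})"
  have "compact e'" if "e' \<in> F T \<union> F T'" for e'
    using that T(1) T'(1) flat_face compact_flat_face by blast
  then have "closed C"
    unfolding C_def using finite_faces T(1) T'(1) by (intro compact_imp_closed compact_Union) auto
  \<comment> \<open>Off the skeleton, a face through x has x in its relative interior, and relative
    interiors of distinct faces are disjoint.\<close>
  have "x \<notin> C"
  proof
    assume "x \<in> C"
    then obtain e' S where e': "e' \<in> F S" "S = T \<or> S = T'" "e' \<noteq> e" "x \<in> e'" unfolding C_def by blast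
    then have "x \<in> rel_interior e'" using x(2) T(1) T'(1) unfolding skeleton_def by blast
    then show False using faces_disjoint[OF T(1) _ T(2) e'(1) x(1)] e' T(1) T'(1) by blast
  qed
  then obtain r1 where r1: "r1 > 0" "ball x r1 \<inter> C = {}"
    using \<open>closed C\<close> open_contains_ball[of "- C"] by blast
  obtain r2 where r2: "r2 > 0" "ball x r2 \<inter> affine hull e \<subseteq> e"
    using x(1) mem_rel_interior_ball by blast
  define r where "r = min r1 r2"
  have r: "r > 0" "ball x r \<inter> C = {}" "ball x r \<inter> affine hull e \<subseteq> e"
    using r1 r2 by (auto simp: r_def)
  have xe: "x \<in> e" using x(1) rel_interior_subset by blast
  obtain \<nu> where \<nu>: "outward_normal T e \<nu>" using ex_outward_normal[OF T] by blast
  obtain \<nu>' where \<nu>': "outward_normal T' e \<nu>'" using ex_outward_normal[OF T'] by blast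
  have nt: "normal_to e \<nu>" using \<nu> unfolding outward_normal_def by blast
  have ad: "aff_dim e = int DIM('a) - 1"
    using flat_face[OF T] unfolding flat_face_def by (elim conjE)
  have inner_pt: "\<exists>t>0. t < r \<and> x - t *\<^sub>R \<mu> \<in> interior S \<and> x - t *\<^sub>R \<mu> \<in> ball x r" if on: "outward_normal S e \<mu>" for S \<mu>
  proof -
    have n1: "norm \<mu> = 1" using on by (simp add: outward_normal_def normal_to_def)
    obtain \<epsilon> where "\<epsilon> > 0" "\<And>t. 0 < t \<and> t < \<epsilon> \<Longrightarrow> x - t *\<^sub>R \<mu> \<in> interior S"
      using on x(1) unfolding outward_normal_def by metis
    then show ?thesis using r(1) n1
      by (intro exI[of _ "min (\<epsilon>/2) (r/2)"]) (auto simp: dist_norm)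
  qed
  have half: "H \<subseteq> interior S"
    if "S = T \<or> S = T'" "connected H" "H \<subseteq> ball x r - {y. \<nu> \<bullet> y = \<nu> \<bullet> x}" "w \<in> H" "w \<in> interior S" for H S w
  proof -
    have "frontier S \<inter> ball x r \<subseteq> {y. \<nu> \<bullet> y = \<nu> \<bullet> x}"
    proof
      fix y assume y: "y \<in> frontier S \<inter> ball x r"
      then have "y \<in> \<Union>(F S)" using that(1) T(1) T'(1) frontier_elem by blast
      then have "y \<in> e" using y r(2) that(1) unfolding C_def by blast
      then show "y \<in> {y. \<nu> \<bullet> y = \<nu> \<bullet> x}" using normal_toD[OF nt _ xe] by blast
    qed
    then have "H \<inter> frontier S = {}" using that(3) by blast
    then have "H \<inter> frontier (interior S) = {}" using frontier_interior_subset by blast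
    then show ?thesis using connected_Int_frontier[OF that(2), of "interior S"] that(4,5) by blast
  qed
  define Hm where "Hm = ball x r \<inter> {y. \<nu> \<bullet> y < \<nu> \<bullet> x}"
  define Hp where "Hp = ball x r \<inter> {y. \<nu> \<bullet> y > \<nu> \<bullet> x}"
  have conn: "connected Hm" "connected Hp"
    unfolding Hm_def Hp_def
    by (intro convex_connected convex_Int convex_ball convex_halfspace_lt convex_halfspace_gt)+
  obtain t where t: "t > 0" "x - t *\<^sub>R \<nu> \<in> interior T" "x - t *\<^sub>R \<nu> \<in> ball x r" using inner_pt[OF \<nu>] by blast
  have "\<nu> \<bullet> \<nu> = 1" using nt by (simp add: normal_to_def dot_square_norm)
  then have "x - t *\<^sub>R \<nu> \<in> Hm" using t by (simp add: Hm_def inner_diff_right)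
  moreover have "Hm \<subseteq> ball x r - {y. \<nu> \<bullet> y = \<nu> \<bullet> x}" by (auto simp: Hm_def)
  ultimately have Hm: "Hm \<subseteq> interior T" using half[OF _ conn(1) _ _ t(2)] by blast
  obtain t' where t': "x - t' *\<^sub>R \<nu>' \<in> interior T'" "x - t' *\<^sub>R \<nu>' \<in> ball x r" using inner_pt[OF \<nu>'] by blast
  \<comment> \<open>This point of T' settles on which side T' lies without comparing the two
    normals: it avoids the half that belongs to T, and it avoids the hyperplane, which inside the
    ball lies in e and so in the frontier of T'.\<close>
  let ?w = "x - t' *\<^sub>R \<nu>'"
  have "?w \<notin> Hm" using Hm t'(1) interiors_disjoint[OF T(1) T'(1)] \<open>T \<noteq> T'\<close> by blast
  moreover have "\<nu> \<bullet> ?w \<noteq> \<nu> \<bullet> x"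
  proof
    assume "\<nu> \<bullet> ?w = \<nu> \<bullet> x"
    then have "?w \<in> affine hull e"
      by (intro normal_to_affine_hull[OF nt ad hull_inc[OF xe]] inner_diff_eq_0_iff[THEN iffD2])
    then have "?w \<in> e" using r(3) t'(2) by blast
    then have "?w \<in> frontier T'" using frontier_elem[OF T'(1)] T'(2) by blast
    then show False using t'(1) by (simp add: frontier_def)
  qed
  ultimately have "?w \<in> Hp" using t'(2) unfolding Hm_def Hp_def by auto
  moreover have "Hp \<subseteq> ball x r - {y. \<nu> \<bullet> y = \<nu> \<bullet> x}" by (auto simp: Hp_def)
  ultimately have Hp: "Hp \<subseteq> interior T'" using half[OF _ conn(2) _ _ t'(1)] by blast
  have "ball x r \<subseteq> T \<union> T'"
  proof
    fix y assume y: "y \<in> ball x r"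
    consider "\<nu> \<bullet> y < \<nu> \<bullet> x" | "\<nu> \<bullet> y > \<nu> \<bullet> x" | "\<nu> \<bullet> y = \<nu> \<bullet> x" by linarith
    then show "y \<in> T \<union> T'"
    proof cases
      case 1
      then show ?thesis using y Hm interior_subset unfolding Hm_def by blast
    next
      case 2
      then show ?thesis using y Hp interior_subset unfolding Hp_def by blast
    next
      case 3
      then have "y \<in> affine hull e"
        by (intro normal_to_affine_hull[OF nt ad hull_inc[OF xe]]) (simp add: inner_diff_eq_0_iff)
      then show ?thesis using y r(3) face_subset_elem[OF T] by blast
    qed
  qed
  then show ?thesis using r(1) by (intro interiorI[of "ball x r"]) auto
qed

text \<open>The union of the elements carrying a nonzero value has its frontier inside the skeleton, while almost
  every line in a fixed direction misses the skeleton.\<close>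

lemma face_constant_imp_0:
  fixes c :: "'a set \<Rightarrow> real"
  assumes bd: "\<And>T e. T \<in> Th \<Longrightarrow> e \<in> F T \<Longrightarrow> e \<subseteq> frontier \<Omega> \<Longrightarrow> c T = 0"
    and shared: "\<And>T T' e. T \<in> Th \<Longrightarrow> T' \<in> Th \<Longrightarrow> e \<in> F T \<Longrightarrow> e \<in> F T' \<Longrightarrow> c T = c T'"
    and T0: "T0 \<in> Th"
  shows "c T0 = 0"
proof (rule ccontr)
  assume nz: "c T0 \<noteq> 0"
  define U where "U = \<Union>{T \<in> Th. c T = c T0}"
  have cU: "compact U" unfolding U_def using finite_Th compact_elem by (intro compact_Union) auto
  have sub: "T \<subseteq> U" if "T \<in> Th" "c T = c T0" for T using that unfolding U_def by blast
  have fr: "frontier U \<subseteq> skeleton"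
  proof
    fix x assume x: "x \<in> frontier U"
    then have "x \<in> U" using cU compact_imp_closed frontier_subset_closed by blast
    then obtain T where T: "T \<in> Th" "c T = c T0" "x \<in> T" unfolding U_def by blast
    have "x \<notin> interior T" using x interior_mono[OF sub[OF T(1,2)]] by (auto simp: frontier_def)
    then have "x \<in> frontier T" using T(3) closure_subset by (auto simp: frontier_def)
    then obtain e where e: "e \<in> F T" "x \<in> e" using frontier_elem[OF T(1)] by blast
    show "x \<in> skeleton"
    proof (rule ccontr)
      assume ns: "x \<notin> skeleton"
      then have xr: "x \<in> rel_interior e" using e T(1) unfolding skeleton_def by blast
      \<comment> \<open>A boundary face would force the value on T to be 0, but it is the nonzero
        value of T0; hence e has a neighbour on its other side.\<close>
      have "\<not> e \<subseteq> frontier \<Omega>" using bd[OF T(1) e(1)] T(2) nz by auto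
      then obtain T' where T': "T' \<in> Th" "T' \<noteq> T" "e \<in> F T'" using face_boundary_or_shared[OF T(1) e(1)] by blast
      have "c T' = c T0" using shared[OF T(1) T'(1) e(1) T'(3)] T(2) by simp
      then have "T \<union> T' \<subseteq> U" using sub T T'(1) by blast
      moreover have "x \<in> interior (T \<union> T')"
        using shared_face_interior[OF T(1) e(1) T'(1,3) _ xr ns] T'(2) by blast
      ultimately have "x \<in> interior U" using interior_mono by blast
      then show False using x by (simp add: frontier_def)
    qed
  qed
  obtain b :: 'a where b: "b \<in> Basis" using nonempty_Basis by blast
  obtain M where M: "\<And>x. x \<in> U \<Longrightarrow> norm x \<le> M" using compact_imp_bounded[OF cU] bounded_iff by blast
  \<comment> \<open>For x in U the norm of x - R b is at least R - M = M + 1, so this point lies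
    outside U. The segment from x to it crosses the frontier of U at a point of the skeleton, whose
    shadow then contains x.\<close>
  define R where "R = 2 * M + 1"
  define shadow where "shadow e = {y + t *\<^sub>R b | y t. y \<in> e - rel_interior e \<and> 0 \<le> t \<and> t \<le> R}" for e
  have "interior T0 \<subseteq> (\<Union>T\<in>Th. \<Union>e\<in>F T. shadow e)"
  proof
    fix x assume "x \<in> interior T0"
    then have xU: "x \<in> U" using sub[OF T0] interior_subset by blast
    have "R \<ge> 0" using M[OF xU] norm_ge_zero[of x] unfolding R_def by linarith
    have "norm (R *\<^sub>R b) \<le> norm x + norm (x - R *\<^sub>R b)" using norm_triangle_ineq4[of x "x - R *\<^sub>R b"] by simp
    then have "x - R *\<^sub>R b \<notin> U"
      using M[of "x - R *\<^sub>R b"] M[OF xU] b \<open>R \<ge> 0\<close> unfolding R_def by auto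
    then have "closed_segment x (x - R *\<^sub>R b) \<inter> frontier U \<noteq> {}"
      using xU by (intro connected_Int_frontier) auto
    then obtain s where s: "0 \<le> s" "s \<le> 1" "(1 - s) *\<^sub>R x + s *\<^sub>R (x - R *\<^sub>R b) \<in> frontier U"
      by (auto simp: closed_segment_def)
    define y where "y = x - (s * R) *\<^sub>R b"
    have "y \<in> skeleton" using s(3) fr by (auto simp: y_def algebra_simps)
    then obtain T e where e: "T \<in> Th" "e \<in> F T" "y \<in> e - rel_interior e" unfolding skeleton_def by blast
    have "x = y + (s * R) *\<^sub>R b" "0 \<le> s * R" "s * R \<le> R"
      using s(1,2) \<open>R \<ge> 0\<close> by (auto simp: y_def mult_left_le_one_le)
    then have "x \<in> shadow e" using e(3) unfolding shadow_def by blast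
    then show "x \<in> (\<Union>T\<in>Th. \<Union>e\<in>F T. shadow e)" using e by blast
  qed
  moreover have "negligible (\<Union>T\<in>Th. \<Union>e\<in>F T. shadow e)"
  proof -
    have "negligible (shadow e)" if "T \<in> Th" "e \<in> F T" for T e
      unfolding shadow_def using negligible_rel_boundary_shadow[OF flat_face[OF that]] ex_normal[OF that] by blast
    then show ?thesis using finite_Th finite_faces by (intro negligible_Union) (auto intro!: negligible_Union)
  qed
  ultimately show False
    using open_not_negligible[OF open_interior interior_elem_nonempty[OF T0]] negligible_subset by blast
qed

text \<open>Norm equivalence takes zero energy to one constant per element. On a shared face
  \<open>snd v\<close> is single-valued, so the constants agree; on a boundary face
  \<open>Vh0\<close> makes the constant 0. The canonical representatives turn this into v = 0 as a
  pair of functions.\<close>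

lemma energy_definite:
  assumes normeq: "\<exists>C1 C2. 0 < C1 \<and> 0 < C2 \<and> (\<forall>v\<in>Vh Th F k.
                    C1 * norm1h Th F v \<le> tnorm Th F k v \<and> tnorm Th F k v \<le> C2 * norm1h Th F v)"
    and v0: "v \<in> Vh0 \<Omega> Th F k" and "energy k v v = 0"
  shows "v = 0"
proof -
  have v: "v \<in> Vh Th F k" using v0 Vh0_subset by blast
  obtain K where "0 < K" "K * norm1h Th F v \<le> tnorm Th F k v" using normeq v by blast
  then have n0: "norm1h Th F v \<le> 0" using assms(3) tnorm_eq_0_iff[of k v] by (simp add: mult_le_0_iff)
  have "\<exists>c. (\<forall>x\<in>interior T. fst v x = c) \<and> (\<forall>e\<in>F T. \<forall>x\<in>rel_interior e. snd v x = c)" if "T \<in> Th" for T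
    using norm1h_eq_0_imp_constant[OF v n0 that] by metis
  then obtain c where c: "\<And>T x. T \<in> Th \<Longrightarrow> x \<in> interior T \<Longrightarrow> fst v x = c T"
    "\<And>T e x. T \<in> Th \<Longrightarrow> e \<in> F T \<Longrightarrow> x \<in> rel_interior e \<Longrightarrow> snd v x = c T" by metis
  have c0: "c T = 0" if "T \<in> Th" for T
  proof (rule face_constant_imp_0[OF _ _ that])
    fix T e assume T: "T \<in> Th" "e \<in> F T"
    obtain x where x: "x \<in> rel_interior e" using flat_face_rel_interior_nonempty[OF flat_face[OF T]] by blast
    show "c T = 0" if "e \<subseteq> frontier \<Omega>"
      using v0 that T x c(2)[OF T x] unfolding Vh0_def by auto
    show "c T = c T'" if "T' \<in> Th" "e \<in> F T'" for T'
      using c(2)[OF T x] c(2)[OF that x] by simp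
  qed
  have "fst v x = 0" for x
    using v c(1) c0 unfolding Vh_def by (cases "x \<in> \<Union>(interior ` Th)") auto
  moreover have "snd v x = 0" for x
    using v c(2) c0 unfolding Vh_def by (cases "x \<in> \<Union>{rel_interior e | e T. T \<in> Th \<and> e \<in> F T}") auto
  ultimately show ?thesis by (simp add: prod_eq_iff fun_eq_iff)
qed

section \<open>Dimension, measurability and boundedness of weak functions; the source
  functional\<close>

lemma Vh_pieces:
  assumes v: "v \<in> Vh Th F k"
  obtains p where "\<And>T. T \<in> Th \<Longrightarrow> p T \<in> Poly k" "fst v = pieces p"
proof -
  have "\<exists>p\<in>Poly k. \<forall>x\<in>interior T. fst v x = p x" if "T \<in> Th" for T using Vh_elem[OF v that] .
  then obtain p where p: "\<And>T. T \<in> Th \<Longrightarrow> p T \<in> Poly k" "\<And>T x. T \<in> Th \<Longrightarrow> x \<in> interior T \<Longrightarrow> fst v x = p T x" by metis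
  have "fst v x = pieces p x" for x
  proof (cases "x \<in> \<Union>(interior ` Th)")
    case True
    then obtain T where "T \<in> Th" "x \<in> interior T" by blast
    then show ?thesis by (simp add: p(2) pieces_interior)
  next
    case False
    then show ?thesis using v pieces_outside[OF False] unfolding Vh_def by auto
  qed
  then show thesis using that p(1) by blast
qed

text \<open>The spanning set consists of polynomials cut off to one element interior or one face.
  Faces are collected in E so that a shared face counts once; by disjointness of relative interiors
  the sum over E has at most one nonzero term at each point.\<close>

lemma Vh_finite_dim: "\<exists>B. finite B \<and> Vh Th F k \<subseteq> span B"
proof -
  obtain P where P: "finite P" "(Poly k :: ('a \<Rightarrow> real) set) \<subseteq> span P" using Poly_finite_dim by blast
  define E where "E = \<Union>(F ` Th)"
  have finE: "finite E" unfolding E_def using finite_Th finite_faces by blast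
  define I where "I T f = ((\<lambda>x. if x \<in> interior T then f x else 0) :: 'a \<Rightarrow> real, 0 :: 'a \<Rightarrow> real)" for T and f :: "'a \<Rightarrow> real"
  define J where "J e f = (0 :: 'a \<Rightarrow> real, (\<lambda>x. if x \<in> rel_interior e then f x else 0) :: 'a \<Rightarrow> real)" for e and f :: "'a \<Rightarrow> real"
  have linI: "linear (I T)" for T by (rule linearI) (simp_all add: I_def fun_eq_iff)
  have linJ: "linear (J e)" for e by (rule linearI) (simp_all add: J_def fun_eq_iff)
  define B where "B = (\<Union>T\<in>Th. I T ` P) \<union> (\<Union>e\<in>E. J e ` P)"
  have "finite B" unfolding B_def using finite_Th finE P(1) by blast
  moreover have "v \<in> span B" if v: "v \<in> Vh Th F k" for v
  proof -
    obtain p where p: "\<And>T. T \<in> Th \<Longrightarrow> p T \<in> Poly k" "fst v = pieces p"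
      using Vh_pieces[OF v] by blast
    have "\<exists>p\<in>Poly k. \<forall>x\<in>rel_interior e. snd v x = p x" if "e \<in> E" for e
      using Vh_face[OF v] that unfolding E_def by blast
    then obtain q where q: "\<And>e. e \<in> E \<Longrightarrow> q e \<in> Poly k" "\<And>e x. e \<in> E \<Longrightarrow> x \<in> rel_interior e \<Longrightarrow> snd v x = q e x" by metis
    have "snd v x = (\<Sum>e\<in>E. if x \<in> rel_interior e then q e x else 0)" for x
    proof (cases "\<exists>e\<in>E. x \<in> rel_interior e")
      case True
      then obtain e where e: "e \<in> E" "x \<in> rel_interior e" by blast
      have "(\<Sum>e'\<in>E. if x \<in> rel_interior e' then q e' x else 0) = (\<Sum>e'\<in>E. if e' = e then q e x else 0)"
      proof (intro sum.cong refl)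
        fix e' assume e': "e' \<in> E"
        obtain T1 T2 where "T1 \<in> Th" "e \<in> F T1" "T2 \<in> Th" "e' \<in> F T2"
          using e(1) e' unfolding E_def by blast
        then have "x \<in> rel_interior e' \<longleftrightarrow> e' = e"
          using faces_disjoint[of T2 T1 e' e x] e(2) by blast
        then show "(if x \<in> rel_interior e' then q e' x else 0) = (if e' = e then q e x else 0)"
          by simp
      qed
      then show ?thesis using e q(2) finE by simp
    next
      case False
      then have "snd v x = 0" using v unfolding Vh_def E_def by blast
      moreover have "(\<Sum>e\<in>E. if x \<in> rel_interior e then q e x else 0) = 0"
        using False by (intro sum.neutral) auto
      ultimately show ?thesis by simp
    qed
    then have "v = (\<Sum>T\<in>Th. I T (p T)) + (\<Sum>e\<in>E. J e (q e))"
      by (simp add: prod_eq_iff fun_eq_iff fst_sum snd_sum I_def J_def sum_fun_apply p(2) pieces_def)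
    also have "\<dots> \<in> span B"
    proof (intro span_add span_sum)
      show "I T (p T) \<in> span B" if "T \<in> Th" for T
        using linear_image_in_span[OF linI, of P T B "p T"] p(1)[OF that] P(2) that span_base[of _ B]
        unfolding B_def by blast
      show "J e (q e) \<in> span B" if "e \<in> E" for e
        using linear_image_in_span[OF linJ, of P e B "q e"] q(1)[OF that] P(2) that span_base[of _ B]
        unfolding B_def by blast
    qed
    finally show ?thesis .
  qed
  ultimately show ?thesis by blast
qed

lemma Vh_measurable: "v \<in> Vh Th F k \<Longrightarrow> fst v \<in> borel_measurable borel"
  and Vh_bounded: "v \<in> Vh Th F k \<Longrightarrow> \<exists>M. \<forall>x. \<bar>fst v x\<bar> \<le> M"
proof -
  assume v: "v \<in> Vh Th F k"
  obtain p where p: "\<And>T. T \<in> Th \<Longrightarrow> p T \<in> Poly k" "fst v = pieces p"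
    using Vh_pieces[OF v] by blast
  have cp: "continuous_on UNIV (p T)" if "T \<in> Th" for T using C1_continuous[OF Poly_C1[OF p(1)[OF that]]] .
  have "(\<lambda>x. if x \<in> interior T then p T x else 0) \<in> borel_measurable borel" if "T \<in> Th" for T
    using borel_measurable_continuous_onI[OF cp[OF that]] by (intro measurable_If_set) auto
  then have "pieces p \<in> borel_measurable borel"
    unfolding pieces_def by (intro borel_measurable_sum)
  then show "fst v \<in> borel_measurable borel" by (simp add: p(2))
  have "\<exists>M. \<forall>x\<in>T. \<bar>p T x\<bar> \<le> M" if "T \<in> Th" for T
  proof -
    have "compact (p T ` T)"
      using compact_continuous_image[OF _ compact_elem[OF that]] cp[OF that] continuous_on_subset by blast
    then have "bounded (p T ` T)" by (rule compact_imp_bounded)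
    then show ?thesis by (auto simp: bounded_iff)
  qed
  then obtain M where M: "\<And>T x. T \<in> Th \<Longrightarrow> x \<in> T \<Longrightarrow> \<bar>p T x\<bar> \<le> M T" by metis
  have "\<bar>fst v x\<bar> \<le> (\<Sum>T\<in>Th. \<bar>M T\<bar>)" for x
  proof -
    have "\<bar>fst v x\<bar> \<le> (\<Sum>T\<in>Th. \<bar>if x \<in> interior T then p T x else 0\<bar>)"
      unfolding p(2) pieces_def by (rule sum_abs)
    also have "\<dots> \<le> (\<Sum>T\<in>Th. \<bar>M T\<bar>)"
    proof (rule sum_mono)
      fix T assume "T \<in> Th"
      then show "\<bar>if x \<in> interior T then p T x else 0\<bar> \<le> \<bar>M T\<bar>"
        using M[of T x] interior_subset[of T] by auto
    qed
    finally show ?thesis .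
  qed
  then show "\<exists>M. \<forall>x. \<bar>fst v x\<bar> \<le> M" by blast
qed

text \<open>A bounded function times an L2 function on a set of finite measure. The majorant M (1 +
  f^2), from |f| \<le> 1 + f^2, does the work of Hoelder's inequality.\<close>

lemma source_integrable:
  assumes v: "v \<in> Vh Th F k" and f: "f \<in> borel_measurable (lebesgue_on \<Omega>)"
    "integrable (lebesgue_on \<Omega>) (\<lambda>x. (f x)\<^sup>2)"
  shows "set_integrable lebesgue \<Omega> (\<lambda>x. f x * fst v x)"
proof -
  have \<Omega>: "\<Omega> \<in> sets lebesgue" using open_\<Omega> by simp
  obtain M where M: "\<And>x. \<bar>fst v x\<bar> \<le> M" using Vh_bounded[OF v] by blast
  then have "M \<ge> 0" using abs_ge_zero order_trans by blast
  have "(\<lambda>x. 1 :: real) absolutely_integrable_on \<Omega>"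
    using bounded_set_imp_lmeasurable[OF bounded_\<Omega> \<Omega>] by (rule absolutely_integrable_on_const)
  then have "integrable (lebesgue_on \<Omega>) (\<lambda>x. 1 :: real)"
    using \<Omega> integrable_restrict_space[of \<Omega> lebesgue "\<lambda>x. 1 :: real"] by (simp add: set_integrable_def)
  then have int: "integrable (lebesgue_on \<Omega>) (\<lambda>x. M * (1 + (f x)\<^sup>2))"
    using f(2) by (intro integrable_mult_right Bochner_Integration.integrable_add)
  have "fst v \<in> borel_measurable (lebesgue_on \<Omega>)"
    using Vh_measurable[OF v] by (simp add: measurable_completion measurable_restrict_space1)
  then have "(\<lambda>x. f x * fst v x) \<in> borel_measurable (lebesgue_on \<Omega>)" using f(1) by (rule borel_measurable_times[rotated])
  moreover have "norm (f x * fst v x) \<le> norm (M * (1 + (f x)\<^sup>2))" for x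
  proof -
    have "\<bar>f x\<bar> \<le> 1 + (f x)\<^sup>2"
      using zero_le_power2[of "\<bar>f x\<bar> - 1"] by (simp add: power2_diff)
    then have "\<bar>f x\<bar> * \<bar>fst v x\<bar> \<le> (1 + (f x)\<^sup>2) * M" using M[of x] by (intro mult_mono) auto
    then show ?thesis using \<open>M \<ge> 0\<close> by (simp add: abs_mult mult.commute)
  qed
  ultimately have "integrable (lebesgue_on \<Omega>) (\<lambda>x. f x * fst v x)"
    using Bochner_Integration.integrable_bound[OF int] by blast
  then show ?thesis using \<Omega> integrable_restrict_space[of \<Omega> lebesgue "\<lambda>x. f x * fst v x"] by (simp add: set_integrable_def)
qed

lemma linear_source:
  assumes f: "f \<in> borel_measurable (lebesgue_on \<Omega>)" "integrable (lebesgue_on \<Omega>) (\<lambda>x. (f x)\<^sup>2)"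
  shows "linear_on_set (Vh Th F k) (\<lambda>v. set_lebesgue_integral lebesgue \<Omega> (\<lambda>x. f x * fst v x))"
proof (rule linear_on_setI)
  fix u v assume "u \<in> Vh Th F k" "v \<in> Vh Th F k"
  from set_integral_add(2)[OF source_integrable[OF this(1) f] source_integrable[OF this(2) f]]
  show "set_lebesgue_integral lebesgue \<Omega> (\<lambda>x. f x * fst (u + v) x) =
    set_lebesgue_integral lebesgue \<Omega> (\<lambda>x. f x * fst u x) + set_lebesgue_integral lebesgue \<Omega> (\<lambda>x. f x * fst v x)"
    by (simp add: distrib_left)
next
  fix c :: real and v :: "'a wfun"
  have "(\<lambda>x. f x * fst (c *\<^sub>R v) x) = (\<lambda>x. c * (f x * fst v x))" by (simp add: fun_eq_iff)
  then show "set_lebesgue_integral lebesgue \<Omega> (\<lambda>x. f x * fst (c *\<^sub>R v) x) =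
    c * set_lebesgue_integral lebesgue \<Omega> (\<lambda>x. f x * fst v x)"
    by (simp only: set_integral_mult_right)
qed

end

section \<open>The nonlinear flux\<close>

text \<open>Assumption (A) at one fixed point. It speaks of the product \<kappa> s * s, which leaves
  \<kappa> 0 itself uncontrolled; the estimates are arranged so that \<kappa> 0 meets a factor
  0.\<close>

locale growth =
  fixes \<kappa> :: "real \<Rightarrow> real" and \<alpha> \<beta> :: real
  assumes pos: "0 < \<alpha>" "\<alpha> < \<beta>"
    and lower: "\<And>s t. 0 \<le> s \<Longrightarrow> s \<le> t \<Longrightarrow> \<alpha> * (t - s) \<le> \<kappa> t * t - \<kappa> s * s"
    and upper: "\<And>s t. 0 \<le> s \<Longrightarrow> s \<le> t \<Longrightarrow> \<kappa> t * t - \<kappa> s * s \<le> \<beta> * (t - s)"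
begin

lemma bounds:
  assumes "0 < s"
  shows "\<alpha> \<le> \<kappa> s" "\<kappa> s \<le> \<beta>"
  using lower[of 0 s] upper[of 0 s] assms by auto

text \<open>With s, t the norms and g the inner product, |\<xi> - \<eta>|^2 = (s - t)^2 + 2 (s t -
  g), and the right-hand side is (\<kappa> s s - \<kappa> t t) (s - t) + (\<kappa> s + \<kappa> t)
  (s t - g). The radial parts compare by the growth bound, the angular ones by \<kappa> \<ge>
  \<alpha> and Cauchy-Schwarz.\<close>

lemma flux_monotone:
  fixes \<xi> \<eta> :: "'a::euclidean_space"
  shows "\<alpha> * ((\<xi> - \<eta>) \<bullet> (\<xi> - \<eta>)) \<le> \<kappa> (norm \<xi>) * (\<xi> \<bullet> (\<xi> - \<eta>)) - \<kappa> (norm \<eta>) * (\<eta> \<bullet> (\<xi> - \<eta>))"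
proof -
  define s t g where "s = norm \<xi>" and "t = norm \<eta>" and "g = \<xi> \<bullet> \<eta>"
  have st: "0 \<le> s" "0 \<le> t" by (auto simp: s_def t_def)
  have g: "g \<le> s * t" unfolding g_def s_def t_def by (rule norm_cauchy_schwarz)
  have sq: "\<xi> \<bullet> \<xi> = s\<^sup>2" "\<eta> \<bullet> \<eta> = t\<^sup>2" by (auto simp: s_def t_def dot_square_norm)
  have diag: "\<alpha> * (s - t)\<^sup>2 \<le> (\<kappa> s * s - \<kappa> t * t) * (s - t)"
  proof (cases "t \<le> s")
    case True
    then show ?thesis using mult_right_mono[OF lower[of t s], of "s - t"] st by (simp add: power2_eq_square mult.assoc)
  next
    case False
    then show ?thesis using mult_right_mono[OF lower[of s t], of "t - s"] st
      by (simp add: power2_eq_square algebra_simps)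
  qed
  have cross: "2 * \<alpha> * (s * t - g) \<le> (\<kappa> s + \<kappa> t) * (s * t - g)"
  proof (cases "s = 0 \<or> t = 0")
    case True
    then have "s * t - g = 0" by (auto simp: g_def s_def t_def)
    then show ?thesis by simp
  next
    case False
    then have "\<alpha> \<le> \<kappa> s" "\<alpha> \<le> \<kappa> t" using bounds st by auto
    then show ?thesis using g by (intro mult_right_mono) auto
  qed
  have "(\<xi> - \<eta>) \<bullet> (\<xi> - \<eta>) = \<xi> \<bullet> \<xi> - 2 * (\<xi> \<bullet> \<eta>) + \<eta> \<bullet> \<eta>"
    by (simp add: inner_diff_left inner_diff_right inner_commute)
  then have dd: "(\<xi> - \<eta>) \<bullet> (\<xi> - \<eta>) = s\<^sup>2 - 2 * g + t\<^sup>2" using sq by (simp add: g_def)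
  have x1: "\<xi> \<bullet> (\<xi> - \<eta>) = s\<^sup>2 - g" using sq by (simp add: inner_diff_right g_def)
  have x2: "\<eta> \<bullet> (\<xi> - \<eta>) = g - t\<^sup>2" using sq by (simp add: inner_diff_right g_def inner_commute[of \<eta> \<xi>])
  have "\<alpha> * ((\<xi> - \<eta>) \<bullet> (\<xi> - \<eta>)) = \<alpha> * (s - t)\<^sup>2 + 2 * \<alpha> * (s * t - g)"
    unfolding dd by (simp add: power2_eq_square algebra_simps)
  also have "\<dots> \<le> (\<kappa> s * s - \<kappa> t * t) * (s - t) + (\<kappa> s + \<kappa> t) * (s * t - g)"
    using diag cross by linarith
  also have "\<dots> = \<kappa> s * (\<xi> \<bullet> (\<xi> - \<eta>)) - \<kappa> t * (\<eta> \<bullet> (\<xi> - \<eta>))"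
    unfolding x1 x2 by (simp add: power2_eq_square algebra_simps)
  finally show ?thesis by (simp add: s_def t_def)
qed

text \<open>The difference splits into \<kappa> s (\<xi> - \<eta>) and (\<kappa> s - \<kappa> t)
  \<eta>, each costing \<beta>. For the second, (\<kappa> s - \<kappa> t) t is the difference of
  \<kappa> s s - \<kappa> t t and \<kappa> s (s - t); as t \<le> s, both lie between 0 and \<beta>
  (s - t).\<close>

lemma flux_diff_ordered:
  fixes \<xi> \<eta> :: "'a::euclidean_space"
  assumes "norm \<eta> \<le> norm \<xi>"
  shows "norm (\<kappa> (norm \<xi>) *\<^sub>R \<xi> - \<kappa> (norm \<eta>) *\<^sub>R \<eta>) \<le> 2 * \<beta> * norm (\<xi> - \<eta>)"
proof (cases "\<xi> = 0")
  case True
  then show ?thesis using assms by simp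
next
  case False
  define s t where "s = norm \<xi>" and "t = norm \<eta>"
  have st: "0 < s" "0 \<le> t" "t \<le> s" using False assms by (auto simp: s_def t_def)
  have ks: "0 \<le> \<kappa> s" "\<kappa> s \<le> \<beta>" using bounds[OF st(1)] pos by auto
  have tri: "s - t \<le> norm (\<xi> - \<eta>)" unfolding s_def t_def by (rule norm_triangle_ineq2)
  have "\<kappa> s * (s - t) \<le> \<beta> * (s - t)" "0 \<le> \<kappa> s * (s - t)" "0 \<le> \<alpha> * (s - t)"
    using ks st pos by (auto intro: mult_right_mono)
  then have "\<bar>(\<kappa> s - \<kappa> t) * t\<bar> \<le> \<beta> * (s - t)"
    using lower[of t s] upper[of t s] st by (simp add: abs_le_iff algebra_simps)
  also have "\<dots> \<le> \<beta> * norm (\<xi> - \<eta>)" using tri pos by (intro mult_left_mono) auto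
  finally have 2: "norm ((\<kappa> s - \<kappa> t) *\<^sub>R \<eta>) \<le> \<beta> * norm (\<xi> - \<eta>)" by (simp add: t_def abs_mult)
  have 1: "norm (\<kappa> s *\<^sub>R (\<xi> - \<eta>)) \<le> \<beta> * norm (\<xi> - \<eta>)"
    using ks by (auto intro: mult_right_mono)
  have "\<kappa> s *\<^sub>R \<xi> - \<kappa> t *\<^sub>R \<eta> = \<kappa> s *\<^sub>R (\<xi> - \<eta>) + (\<kappa> s - \<kappa> t) *\<^sub>R \<eta>" by (simp add: algebra_simps)
  then have "norm (\<kappa> s *\<^sub>R \<xi> - \<kappa> t *\<^sub>R \<eta>) \<le> 2 * \<beta> * norm (\<xi> - \<eta>)"
    using norm_triangle_le[of "\<kappa> s *\<^sub>R (\<xi> - \<eta>)" "(\<kappa> s - \<kappa> t) *\<^sub>R \<eta>"] 1 2 by simp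
  then show ?thesis by (simp add: s_def t_def)
qed

lemma flux_lipschitz:
  fixes \<xi> \<eta> :: "'a::euclidean_space"
  shows "norm (\<kappa> (norm \<xi>) *\<^sub>R \<xi> - \<kappa> (norm \<eta>) *\<^sub>R \<eta>) \<le> 2 * \<beta> * norm (\<xi> - \<eta>)"
  using flux_diff_ordered[of \<xi> \<eta>] flux_diff_ordered[of \<eta> \<xi>]
  by (cases "norm \<eta> \<le> norm \<xi>") (auto simp: norm_minus_commute)

lemma flux_bound:
  fixes \<xi> \<zeta> :: "'a::euclidean_space"
  shows "\<bar>\<kappa> (norm \<xi>) * (\<xi> \<bullet> \<zeta>)\<bar> \<le> 2 * \<beta> * (norm \<xi> * norm \<zeta>)"
proof -
  have "\<bar>\<kappa> (norm \<xi>) * (\<xi> \<bullet> \<zeta>)\<bar> = \<bar>(\<kappa> (norm \<xi>) *\<^sub>R \<xi>) \<bullet> \<zeta>\<bar>" by simp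
  also have "\<dots> \<le> norm (\<kappa> (norm \<xi>) *\<^sub>R \<xi>) * norm \<zeta>" by (rule Cauchy_Schwarz_ineq2)
  also have "\<dots> \<le> 2 * \<beta> * norm \<xi> * norm \<zeta>"
    using flux_lipschitz[of \<xi> 0] by (intro mult_right_mono) auto
  finally show ?thesis by (simp add: mult.assoc)
qed

text \<open>The factor 2 of the Lipschitz constant 2 \<beta> is absorbed by 2 a b \<le> a^2 + b^2,
  which gives \<Lambda> = \<beta> in the abstract theorem.\<close>

lemma flux_lipschitz_young:
  fixes \<xi> \<eta> \<zeta> :: "'a::euclidean_space"
  shows "\<kappa> (norm \<xi>) * (\<xi> \<bullet> \<zeta>) - \<kappa> (norm \<eta>) * (\<eta> \<bullet> \<zeta>) \<le> \<beta> * ((\<xi> - \<eta>) \<bullet> (\<xi> - \<eta>) + \<zeta> \<bullet> \<zeta>)"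
proof -
  have "\<kappa> (norm \<xi>) * (\<xi> \<bullet> \<zeta>) - \<kappa> (norm \<eta>) * (\<eta> \<bullet> \<zeta>) = (\<kappa> (norm \<xi>) *\<^sub>R \<xi> - \<kappa> (norm \<eta>) *\<^sub>R \<eta>) \<bullet> \<zeta>"
    by (simp add: inner_diff_left)
  also have "\<dots> \<le> norm (\<kappa> (norm \<xi>) *\<^sub>R \<xi> - \<kappa> (norm \<eta>) *\<^sub>R \<eta>) * norm \<zeta>" by (rule norm_cauchy_schwarz)
  also have "\<dots> \<le> 2 * \<beta> * norm (\<xi> - \<eta>) * norm \<zeta>" using flux_lipschitz by (intro mult_right_mono) auto
  also have "\<dots> = \<beta> * (2 * norm (\<xi> - \<eta>) * norm \<zeta>)" by simp
  also have "\<dots> \<le> \<beta> * ((norm (\<xi> - \<eta>))\<^sup>2 + (norm \<zeta>)\<^sup>2)"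
    using pos by (intro mult_left_mono sum_squares_bound) auto
  finally show ?thesis by (simp add: dot_square_norm)
qed

end

text \<open>The composition is a limit of compositions with countably-valued functions. The limit may differ from
  it where continuity fails, so a measurable substitute is returned instead.\<close>

lemma caratheodory_compose:
  fixes g :: "'a::euclidean_space \<Rightarrow> real"
  assumes meas: "\<And>s. 0 \<le> s \<Longrightarrow> (\<lambda>x. \<kappa> x s) \<in> borel_measurable M"
    and g: "g \<in> borel_measurable M" "\<And>x. 0 \<le> g x"
  obtains h where "h \<in> borel_measurable M" "\<And>x. continuous_on {0..} (\<kappa> x) \<Longrightarrow> h x = (\<kappa> x (g x) :: real)"
proof -
  \<comment> \<open>The argument is rounded down to the grid of width 1 / (n + 1), so countably many
    values occur for each n; \<open>Suc n\<close> avoids a zero denominator.\<close>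
  define s where "s n x = real (nat \<lfloor>real (Suc n) * g x\<rfloor>) / real (Suc n)" for n x
  define h where "h x = lim (\<lambda>n. \<kappa> x (s n x))" for x
  have m: "(\<lambda>x. \<kappa> x (s n x)) \<in> borel_measurable M" for n
  proof -
    have "(\<lambda>x. \<lfloor>real (Suc n) * g x\<rfloor>) \<in> measurable M (count_space UNIV)"
      using g(1) by measurable
    then have "(\<lambda>x. nat \<lfloor>real (Suc n) * g x\<rfloor>) \<in> measurable M (count_space UNIV)"
      by (rule measurable_compose) simp
    moreover have "(\<lambda>x. \<kappa> x (real i / real (Suc n))) \<in> borel_measurable M" for i
      by (intro meas) simp
    ultimately show ?thesis
      unfolding s_def using measurable_compose_countable[of "\<lambda>i x. \<kappa> x (real i / real (Suc n))"] by blast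
  qed
  have "h \<in> borel_measurable M" unfolding h_def using m by (intro borel_measurable_lim_metric)
  moreover have "h x = \<kappa> x (g x)" if c: "continuous_on {0..} (\<kappa> x)" for x
  proof -
    have bnd: "\<bar>s n x - g x\<bar> \<le> 1 / real (Suc n)" for n
    proof -
      have "0 \<le> real (Suc n) * g x" using g(2) by simp
      then have "real (nat \<lfloor>real (Suc n) * g x\<rfloor>) = of_int \<lfloor>real (Suc n) * g x\<rfloor>" by simp
      then have "\<bar>real (nat \<lfloor>real (Suc n) * g x\<rfloor>) - real (Suc n) * g x\<bar> \<le> 1"
        using of_int_floor_le[of "real (Suc n) * g x"] floor_correct[of "real (Suc n) * g x"] by linarith
      moreover have "s n x - g x = (real (nat \<lfloor>real (Suc n) * g x\<rfloor>) - real (Suc n) * g x) / real (Suc n)"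
        by (simp add: s_def field_simps)
      ultimately show ?thesis by (simp add: abs_divide divide_right_mono)
    qed
    have "(\<lambda>n. s n x - g x) \<longlonglongrightarrow> 0"
    proof (rule Lim_null_comparison[where g="\<lambda>n. 1 / real (Suc n)"])
      show "(\<lambda>n. 1 / real (Suc n)) \<longlonglongrightarrow> 0"
        using LIMSEQ_inverse_real_of_nat by (simp only: inverse_eq_divide)
      show "\<forall>\<^sub>F n in sequentially. norm (s n x - g x) \<le> 1 / real (Suc n)"
        using bnd by (intro always_eventually allI) (simp only: real_norm_def)
    qed
    then have "(\<lambda>n. s n x) \<longlonglongrightarrow> g x" by (rule LIM_zero_cancel)
    moreover have "\<forall>n. s n x \<in> {0..}" by (simp add: s_def)
    ultimately have "(\<lambda>n. \<kappa> x (s n x)) \<longlonglongrightarrow> \<kappa> x (g x)"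
      using c g(2)[of x] unfolding continuous_on_sequentially by (auto simp: comp_def)
    then show ?thesis unfolding h_def by (rule limI)
  qed
  ultimately show thesis using that by blast
qed

text \<open>The almost-everywhere conditions are merged into a single null set, off which
  \<open>growth\<close> can be interpreted point by point.\<close>

lemma assumptionA_exceptional_set:
  assumes "assumptionA \<Omega> \<kappa> \<alpha> \<beta>"
  obtains N where "negligible N" "\<And>x. x \<in> \<Omega> - N \<Longrightarrow> growth (\<kappa> x) \<alpha> \<beta>"
    "\<And>x. x \<in> \<Omega> - N \<Longrightarrow> continuous_on {0..} (\<kappa> x)"
proof -
  have pos: "0 < \<alpha>" "\<alpha> < \<beta>" using assms unfolding assumptionA_def by blast+
  have "AE x in lebesgue. x \<in> \<Omega> \<longrightarrow> continuous_on {0..} (\<kappa> x)"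
    using assms unfolding assumptionA_def caratheodory_def by blast
  moreover have "AE x in lebesgue. x \<in> \<Omega> \<longrightarrow>
        (\<forall>s t. 0 \<le> s \<and> s \<le> t \<longrightarrow>
           \<alpha> * (t - s) \<le> \<kappa> x t * t - \<kappa> x s * s \<and> \<kappa> x t * t - \<kappa> x s * s \<le> \<beta> * (t - s))"
    using assms unfolding assumptionA_def by blast
  ultimately have "AE x in lebesgue. x \<in> \<Omega> \<longrightarrow> continuous_on {0..} (\<kappa> x) \<and> growth (\<kappa> x) \<alpha> \<beta>"
    by eventually_elim (use pos in \<open>auto simp: growth_def\<close>)
  then obtain N where "N \<in> null_sets lebesgue"
    "{x \<in> space lebesgue. \<not> (x \<in> \<Omega> \<longrightarrow> continuous_on {0..} (\<kappa> x) \<and> growth (\<kappa> x) \<alpha> \<beta>)} \<subseteq> N"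
    by (auto simp: eventually_ae_filter)
  then show thesis using that[of N] by (auto simp: negligible_iff_null_sets)
qed

section \<open>Integrability, monotonicity and Lipschitz bound of the nonlinear form\<close>

context polytopal_elements
begin

lemma interior_elem_subset: "T \<in> Th \<Longrightarrow> interior T \<subseteq> \<Omega>"
  unfolding \<Omega>_eq by (intro interior_mono) blast

text \<open>Measurability comes from continuous substitutes p, q for W, Z and a measurable
  substitute h for the composed coefficient; \<open>flux_bound\<close> supplies the majorant on the
  interior minus the exceptional set. The other points of T form a null set, so T and the original
  integrand are reached by changes on null sets.\<close>

lemma flux_integrable:
  assumes A: "assumptionA \<Omega> \<kappa> \<alpha> \<beta>" and T: "T \<in> Th" and W: "cont_on_elem T W" and Z: "cont_on_elem T Z"
  shows "(\<lambda>x. \<kappa> x (norm (W x)) * (W x \<bullet> Z x)) absolutely_integrable_on T"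
proof -
  obtain p where p: "continuous_on UNIV p" "\<And>x. x \<in> interior T \<Longrightarrow> W x = p x"
    using W unfolding cont_on_elem_def by blast
  obtain q where q: "continuous_on UNIV q" "\<And>x. x \<in> interior T \<Longrightarrow> Z x = q x"
    using Z unfolding cont_on_elem_def by blast
  obtain N where N: "negligible N" "\<And>x. x \<in> \<Omega> - N \<Longrightarrow> growth (\<kappa> x) \<alpha> \<beta>"
    "\<And>x. x \<in> \<Omega> - N \<Longrightarrow> continuous_on {0..} (\<kappa> x)"
    using assumptionA_exceptional_set[OF A] by blast
  have borel: "f \<in> borel_measurable (lebesgue_on S)" if "continuous_on UNIV f" for f :: "'a \<Rightarrow> real" and S
    using borel_measurable_continuous_onI[OF that] by (simp add: measurable_completion measurable_restrict_space1)
  have cnp: "continuous_on UNIV (\<lambda>x. norm (p x))" and cpq: "continuous_on UNIV (\<lambda>x. p x \<bullet> q x)"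
    and cb: "continuous_on UNIV (\<lambda>x. 2 * \<beta> * (norm (p x) * norm (q x)))"
    using p(1) q(1) by (auto intro!: continuous_intros)
  have km: "(\<lambda>x. \<kappa> x s) \<in> borel_measurable (lebesgue_on \<Omega>)" if "0 \<le> s" for s
    using A that unfolding assumptionA_def caratheodory_def by blast
  obtain h where h: "h \<in> borel_measurable (lebesgue_on \<Omega>)"
    "\<And>x. continuous_on {0..} (\<kappa> x) \<Longrightarrow> h x = \<kappa> x (norm (p x))"
    using caratheodory_compose[of \<kappa> "lebesgue_on \<Omega>" "\<lambda>x. norm (p x)", OF km borel[OF cnp]] by auto
  define S where "S = interior T - N"
  have S: "S \<in> sets lebesgue" unfolding S_def using negligible_imp_sets[OF N(1)] by auto
  have S\<Omega>: "S \<subseteq> \<Omega> - N" unfolding S_def using interior_elem_subset[OF T] by blast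
  have "h \<in> borel_measurable (lebesgue_on S)"
    using measurable_restrict_mono[OF h(1)] S\<Omega> by blast
  then have hm: "(\<lambda>x. h x * (p x \<bullet> q x)) \<in> borel_measurable (lebesgue_on S)"
    using borel[OF cpq] by (rule borel_measurable_times)
  have "(\<lambda>x. 2 * \<beta> * (norm (p x) * norm (q x))) absolutely_integrable_on T"
    using elem_integrable[OF T cont_on_elem_continuous[OF cb]] .
  then have "(\<lambda>x. 2 * \<beta> * (norm (p x) * norm (q x))) absolutely_integrable_on S"
    by (rule set_integrable_subset[OF _ S]) (use interior_subset in \<open>auto simp: S_def\<close>)
  then have hS: "(\<lambda>x. h x * (p x \<bullet> q x)) absolutely_integrable_on S"
  proof (rule measurable_bounded_by_integrable_imp_absolutely_integrable[OF hm S set_lebesgue_integral_eq_integral(1)])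
    fix x assume x: "x \<in> S"
    interpret growth "\<kappa> x" \<alpha> \<beta> using N(2) x S\<Omega> by blast
    show "norm (h x * (p x \<bullet> q x)) \<le> 2 * \<beta> * (norm (p x) * norm (q x))"
      using flux_bound[of "p x" "q x"] h(2) N(3) x S\<Omega> by auto
  qed
  have TS: "x \<in> S" if "x \<in> T" "x \<notin> N \<union> frontier T" for x
    using elem_minus_frontier[OF T] that unfolding S_def by blast
  have neg: "negligible (N \<union> frontier T)" using N(1) negligible_frontier[OF T] by (rule negligible_Un)
  have hT: "(\<lambda>x. h x * (p x \<bullet> q x)) absolutely_integrable_on T"
  proof (rule absolutely_integrable_spike_set[OF hS])
    have "S \<subseteq> T" using interior_subset unfolding S_def by blast
    then have "{x \<in> S - T. h x * (p x \<bullet> q x) \<noteq> 0} = {}" by blast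
    then show "negligible {x \<in> S - T. h x * (p x \<bullet> q x) \<noteq> 0}" by (simp only: negligible_empty)
    show "negligible {x \<in> T - S. h x * (p x \<bullet> q x) \<noteq> 0}"
      by (rule negligible_subset[OF neg]) (use TS in blast)
  qed
  show ?thesis
  proof (rule set_lebesgue_integral_spike(1)[OF hT neg])
    fix x assume "x \<in> T - (N \<union> frontier T)"
    then have x: "x \<in> S" "x \<in> interior T" using TS unfolding S_def by blast+
    then have "x \<in> \<Omega> - N" using S\<Omega> by blast
    then show "\<kappa> x (norm (W x)) * (W x \<bullet> Z x) = h x * (p x \<bullet> q x)"
      by (simp add: p(2)[OF x(2)] q(2)[OF x(2)] h(2)[OF N(3)])
  qed
qed

lemma ah_linear:
  assumes A: "assumptionA \<Omega> \<kappa> \<alpha> \<beta>" and w: "w \<in> Vh Th F k"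
  shows "linear_on_set (Vh Th F k) (ah \<kappa> Th F k w w)"
proof (rule linear_on_setI)
  fix u v assume uv: "u \<in> Vh Th F k" "v \<in> Vh Th F k"
  show "ah \<kappa> Th F k w w (u + v) = ah \<kappa> Th F k w w u + ah \<kappa> Th F k w w v"
    unfolding ah_def wgrad_add[OF uv] sum.distrib[symmetric]
  proof (intro sum.cong refl)
    fix T assume T: "T \<in> Th"
    show "set_lebesgue_integral lebesgue T (\<lambda>x. \<kappa> x (norm (wgrad Th F k w x)) *
        (wgrad Th F k w x \<bullet> (wgrad Th F k u + wgrad Th F k v) x)) =
      set_lebesgue_integral lebesgue T (\<lambda>x. \<kappa> x (norm (wgrad Th F k w x)) * (wgrad Th F k w x \<bullet> wgrad Th F k u x)) +
      set_lebesgue_integral lebesgue T (\<lambda>x. \<kappa> x (norm (wgrad Th F k w x)) * (wgrad Th F k w x \<bullet> wgrad Th F k v x))"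
      using set_integral_add(2)[OF flux_integrable[OF A T wgrad_cont[OF w T] wgrad_cont[OF uv(1) T]]
          flux_integrable[OF A T wgrad_cont[OF w T] wgrad_cont[OF uv(2) T]]]
      by (simp add: inner_add_right distrib_left)
  qed
next
  fix c and v assume v: "v \<in> Vh Th F k"
  show "ah \<kappa> Th F k w w (c *\<^sub>R v) = c * ah \<kappa> Th F k w w v"
    unfolding ah_def wgrad_scale[OF v] sum_distrib_left
    by (simp add: mult.left_commute[of _ c] set_integral_mult_right)
qed

text \<open>The pointwise inequality for the fluxes is integrated over each element, linearity of
  \<open>wgrad\<close> turning the weak gradient of u - v into the difference of the two.\<close>

lemma ah_monotone:
  assumes A: "assumptionA \<Omega> \<kappa> \<alpha> \<beta>" and uv: "u \<in> Vh Th F k" "v \<in> Vh Th F k"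
  shows "\<alpha> * energy k (u - v) (u - v) \<le> ah \<kappa> Th F k u u (u - v) - ah \<kappa> Th F k v v (u - v)"
proof -
  obtain N where N: "negligible N" "\<And>x. x \<in> \<Omega> - N \<Longrightarrow> growth (\<kappa> x) \<alpha> \<beta>"
    "\<And>x. x \<in> \<Omega> - N \<Longrightarrow> continuous_on {0..} (\<kappa> x)"
    using assumptionA_exceptional_set[OF A] by blast
  have d: "u - v \<in> Vh Th F k" using subspace_diff[OF subspace_Vh uv] .
  let ?g = "wgrad Th F k"
  have "\<alpha> * elem_ip T (?g (u - v)) (?g (u - v)) \<le>
      set_lebesgue_integral lebesgue T (\<lambda>x. \<kappa> x (norm (?g u x)) * (?g u x \<bullet> ?g (u - v) x)) -
      set_lebesgue_integral lebesgue T (\<lambda>x. \<kappa> x (norm (?g v x)) * (?g v x \<bullet> ?g (u - v) x))" if T: "T \<in> Th" for T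
  proof -
    note fi = flux_integrable[OF A T wgrad_cont[OF _ T] wgrad_cont[OF d T]]
    have "(\<lambda>x. ?g (u - v) x \<bullet> ?g (u - v) x) absolutely_integrable_on T"
      by (intro elem_integrable[OF T] cont_on_elem_inner wgrad_cont d T)
    then have "(\<lambda>x. \<alpha> * (?g (u - v) x \<bullet> ?g (u - v) x)) absolutely_integrable_on T"
      by (rule set_integrable_mult_right)
    then have "set_lebesgue_integral lebesgue T (\<lambda>x. \<alpha> * (?g (u - v) x \<bullet> ?g (u - v) x)) \<le>
       set_lebesgue_integral lebesgue T (\<lambda>x. \<kappa> x (norm (?g u x)) * (?g u x \<bullet> ?g (u - v) x) -
         \<kappa> x (norm (?g v x)) * (?g v x \<bullet> ?g (u - v) x))"
    proof (rule set_lebesgue_integral_mono_negligible)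
      show "negligible (N \<union> frontier T)" using N(1) negligible_frontier[OF T] by (rule negligible_Un)
      fix x assume "x \<in> T - (N \<union> frontier T)"
      then have "x \<in> \<Omega> - N" using elem_minus_frontier[OF T] interior_elem_subset[OF T] by blast
      then interpret growth "\<kappa> x" \<alpha> \<beta> by (rule N(2))
      show "\<alpha> * (?g (u - v) x \<bullet> ?g (u - v) x) \<le> \<kappa> x (norm (?g u x)) * (?g u x \<bullet> ?g (u - v) x) -
         \<kappa> x (norm (?g v x)) * (?g v x \<bullet> ?g (u - v) x)"
        using flux_monotone[of "?g u x" "?g v x"] by (simp add: wgrad_diff[OF uv])
    qed (intro set_integral_diff(1) fi uv)
    then show ?thesis by (simp add: elem_ip_def set_integral_diff(2)[OF fi[OF uv(1)] fi[OF uv(2)]])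
  qed
  then show ?thesis
    unfolding energy_def ah_def sum_distrib_left sum_subtractf[symmetric] by (intro sum_mono)
qed

lemma ah_lipschitz:
  assumes A: "assumptionA \<Omega> \<kappa> \<alpha> \<beta>" and uv: "u \<in> Vh Th F k" "v \<in> Vh Th F k" and w: "w \<in> Vh Th F k"
  shows "ah \<kappa> Th F k u u w - ah \<kappa> Th F k v v w \<le> \<beta> * (energy k (u - v) (u - v) + energy k w w)"
proof -
  obtain N where N: "negligible N" "\<And>x. x \<in> \<Omega> - N \<Longrightarrow> growth (\<kappa> x) \<alpha> \<beta>"
    "\<And>x. x \<in> \<Omega> - N \<Longrightarrow> continuous_on {0..} (\<kappa> x)"
    using assumptionA_exceptional_set[OF A] by blast
  have d: "u - v \<in> Vh Th F k" using subspace_diff[OF subspace_Vh uv] .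
  let ?g = "wgrad Th F k"
  have "set_lebesgue_integral lebesgue T (\<lambda>x. \<kappa> x (norm (?g u x)) * (?g u x \<bullet> ?g w x)) -
      set_lebesgue_integral lebesgue T (\<lambda>x. \<kappa> x (norm (?g v x)) * (?g v x \<bullet> ?g w x))
      \<le> \<beta> * (elem_ip T (?g (u - v)) (?g (u - v)) + elem_ip T (?g w) (?g w))" if T: "T \<in> Th" for T
  proof -
    note fi = flux_integrable[OF A T wgrad_cont[OF _ T] wgrad_cont[OF w T]]
    have id: "(\<lambda>x. ?g (u - v) x \<bullet> ?g (u - v) x) absolutely_integrable_on T"
      by (intro elem_integrable[OF T] cont_on_elem_inner wgrad_cont d T)
    have iw: "(\<lambda>x. ?g w x \<bullet> ?g w x) absolutely_integrable_on T"
      by (intro elem_integrable[OF T] cont_on_elem_inner wgrad_cont w T)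
    have "set_lebesgue_integral lebesgue T (\<lambda>x. \<kappa> x (norm (?g u x)) * (?g u x \<bullet> ?g w x) -
         \<kappa> x (norm (?g v x)) * (?g v x \<bullet> ?g w x)) \<le>
       set_lebesgue_integral lebesgue T (\<lambda>x. \<beta> * (?g (u - v) x \<bullet> ?g (u - v) x + ?g w x \<bullet> ?g w x))"
    proof (rule set_lebesgue_integral_mono_negligible)
      show "(\<lambda>x. \<beta> * (?g (u - v) x \<bullet> ?g (u - v) x + ?g w x \<bullet> ?g w x)) absolutely_integrable_on T"
        by (intro set_integrable_mult_right set_integral_add(1) id iw)
      show "negligible (N \<union> frontier T)" using N(1) negligible_frontier[OF T] by (rule negligible_Un)
      fix x assume "x \<in> T - (N \<union> frontier T)"
      then have "x \<in> \<Omega> - N" using elem_minus_frontier[OF T] interior_elem_subset[OF T] by blast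
      then interpret growth "\<kappa> x" \<alpha> \<beta> by (rule N(2))
      show "\<kappa> x (norm (?g u x)) * (?g u x \<bullet> ?g w x) - \<kappa> x (norm (?g v x)) * (?g v x \<bullet> ?g w x)
         \<le> \<beta> * (?g (u - v) x \<bullet> ?g (u - v) x + ?g w x \<bullet> ?g w x)"
        using flux_lipschitz_young[of "?g u x" "?g w x" "?g v x"] by (simp add: wgrad_diff[OF uv])
    qed (intro set_integral_diff(1) fi uv)
    then show ?thesis
      by (simp add: elem_ip_def set_integral_diff(2)[OF fi[OF uv(1)] fi[OF uv(2)]] set_integral_mult_right
          set_integral_add(2)[OF id iw])
  qed
  then have "(\<Sum>T\<in>Th. set_lebesgue_integral lebesgue T (\<lambda>x. \<kappa> x (norm (?g u x)) * (?g u x \<bullet> ?g w x)) -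
      set_lebesgue_integral lebesgue T (\<lambda>x. \<kappa> x (norm (?g v x)) * (?g v x \<bullet> ?g w x)))
      \<le> (\<Sum>T\<in>Th. \<beta> * (elem_ip T (?g (u - v)) (?g (u - v)) + elem_ip T (?g w) (?g w)))"
    by (rule sum_mono)
  then show ?thesis
    by (simp add: energy_def ah_def sum_subtractf sum.distrib flip: sum_distrib_left)
qed

end

theorem mainTheorem4:
  fixes \<Omega> :: "'a::euclidean_space set"
    and Th :: "'a set set" and F :: "'a set \<Rightarrow> 'a set set"
    and k :: nat and \<kappa> :: "'a \<Rightarrow> real \<Rightarrow> real" and \<alpha> \<beta> :: real
    and f :: "'a \<Rightarrow> real"
  assumes dim: "DIM('a) = 2 \<or> DIM('a) = 3"
    and mesh: "polytopal_mesh \<Omega> Th F"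
    and k: "1 \<le> k"
    and normeq: "\<exists>C1 C2. 0 < C1 \<and> 0 < C2 \<and> (\<forall>v\<in>Vh Th F k.
                    C1 * norm1h Th F v \<le> tnorm Th F k v \<and> tnorm Th F k v \<le> C2 * norm1h Th F v)"
    and A: "assumptionA \<Omega> \<kappa> \<alpha> \<beta>"
    and f_meas: "f \<in> borel_measurable (lebesgue_on \<Omega>)"
    and f_L2: "integrable (lebesgue_on \<Omega>) (\<lambda>x. (f x)\<^sup>2)"
  shows "\<exists>!u. u \<in> Vh0 \<Omega> Th F k \<and>
           (\<forall>v\<in>Vh0 \<Omega> Th F k. ah \<kappa> Th F k u u v = set_lebesgue_integral lebesgue \<Omega> (\<lambda>x. f x * fst v x))"
proof -
  interpret polytopal_elements \<Omega> Th F by standard (rule mesh)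
  interpret semi_inner "Vh0 \<Omega> Th F k" "energy k" by (rule semi_inner_energy)
  interpret fin_dim_inner "Vh0 \<Omega> Th F k" "energy k"
  proof
    show "\<exists>B. finite B \<and> Vh0 \<Omega> Th F k \<subseteq> span B" using Vh_finite_dim Vh0_subset by (meson order_trans)
    show "v = 0" if "v \<in> Vh0 \<Omega> Th F k" "energy k v v = 0" for v using energy_definite[OF normeq that] .
  qed
  have pos: "0 < \<alpha>" "0 < \<beta>" using A unfolding assumptionA_def by auto
  have sub: "v \<in> Vh Th F k" if "v \<in> Vh0 \<Omega> Th F k" for v using that Vh0_subset by blast
  show ?thesis
  \<comment> \<open>The abstract operator sends u to the functional
    \<open>ah \<kappa> Th F k u u\<close>; its monotonicity constant is \<alpha>, and \<beta> takes
    the place of \<Lambda>.\<close>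
  proof (rule strongly_monotone_unique_solution[of "\<lambda>u. ah \<kappa> Th F k u u", OF _ _ _ _ pos])
    show "linear_on_set (Vh0 \<Omega> Th F k) (\<lambda>v. set_lebesgue_integral lebesgue \<Omega> (\<lambda>x. f x * fst v x))"
      using linear_on_set_mono[OF linear_source[OF f_meas f_L2] Vh0_subset] .
    show "linear_on_set (Vh0 \<Omega> Th F k) (ah \<kappa> Th F k u u)" if "u \<in> Vh0 \<Omega> Th F k" for u
      using linear_on_set_mono[OF ah_linear[OF A sub[OF that]] Vh0_subset] .
    fix u v assume uv: "u \<in> Vh0 \<Omega> Th F k" "v \<in> Vh0 \<Omega> Th F k"
    show "\<alpha> * energy k (u - v) (u - v) \<le> ah \<kappa> Th F k u u (u - v) - ah \<kappa> Th F k v v (u - v)"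
      by (rule ah_monotone[OF A sub[OF uv(1)] sub[OF uv(2)]])
    show "ah \<kappa> Th F k u u w - ah \<kappa> Th F k v v w \<le> \<beta> * (energy k (u - v) (u - v) + energy k w w)"
      if "w \<in> Vh0 \<Omega> Th F k" for w
      by (rule ah_lipschitz[OF A sub[OF uv(1)] sub[OF uv(2)] sub[OF that]])
  qed
qed

end
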